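(* Equality of arrows in the bifree locally cartesian closed category on one object, presented as the category of contexts of the calculus $\mathcal T^{\mathrm I,\mathrm N_1,\Sigma,\Pi}$ described in the context, is undecidable: there is no algorithm which, given raw contexts $\Gamma,\Delta$ and raw substitutions $\gamma,\gamma'$ such that $\Gamma\vdash\gamma:\Delta$ and $\Gamma\vdash\gamma':\Delta$ are derivable, decides whether $\Gamma\vdash\gamma=\gamma':\Delta$ is derivable.
   Context: **Raw syntax** (contexts, substitutions, types, terms): $\Gamma::=1\mid\Gamma.A$; $\gamma::=\gamma\circ\gamma\mid\mathrm{id}_\Gamma\mid\langle\rangle_\Gamma\mid\mathrm p_A\mid\langle\gamma,a\rangle_A$; $A::=o\mid A[\gamma]\mid\mathrm I(A,a,a)\mid\mathrm N_1\mid\Sigma(A,A)\mid\Pi(A,A)$; $a::=a[\gamma]\mid\mathrm q_A\mid\mathrm r(a)\mid 0_1\mid\mathrm{fst}(A,a)\mid\mathrm{snd}(A,A,a)\mid\mathrm{pair}(A,A,a,a)\mid\mathrm{app}(A,A,a,a)\mid\lambda(A,a)$. **Judgments**, defined simultaneously inductively: $\Gamma=\Gamma'\vdash$, $\Delta\vdash\gamma=\gamma':\Gamma$, $\Gamma\vdash A=A'$, $\Gamma\vdash a=a':A$. Reflexive instances are abbreviated $\Gamma\vdash$, $\Delta\vdash\gamma:\Gamma$, $\Gamma\vdash A$, $\Gamma\vdash a:A$. Write $\gamma^+=\langle\gamma\circ\mathrm p_{A[\gamma]},\mathrm q_{A[\gamma]}\rangle_A$. *Per rules*: each of the four relations is symmetric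 and transitive. *Preservation*: if $\Gamma=\Gamma'\vdash$, $\Delta=\Delta'\vdash$, $\Gamma\vdash\gamma=\gamma':\Delta$ then $\Gamma'\vdash\gamma=\gamma':\Delta'$; if $\Gamma=\Gamma'\vdash$, $\Gamma\vdash A=A'$ then $\Gamma'\vdash A=A'$; if $\Gamma=\Gamma'\vdash$, $\Gamma\vdash A=A'$, $\Gamma\vdash a=a':A$ then $\Gamma'\vdash a=a':A'$. *Congruence*: $1=1\vdash$; $1\vdash o=o$; if $\Gamma=\Gamma'\vdash$ and $\Gamma\vdash A=A'$ then $\Gamma.A=\Gamma'.A'\vdash$; if $\Gamma\vdash A=A'$ and $\Delta\vdash\gamma=\gamma':\Gamma$ then $\Delta\vdash A[\gamma]=A'[\gamma']$; if $\Gamma=\Gamma'\vdash$ then $\Gamma\vdash\mathrm{id}_\Gamma=\mathrm{id}_{\Gamma'}:\Gamma$ and $\Gamma\vdash\langle\rangle_\Gamma=\langle\rangle_{\Gamma'}:1$; if $\Gamma\vdash\delta=\delta':\Delta$ and $\Delta\vdash\gamma=\gamma':\Theta$ then $\Gamma\vdash\gamma\circ\delta=\gamma'\circ\delta':\Theta$; if $\Gamma\vdash A=A'$ then $\Gamma.A\vdash\mathrm p_A=\mathrm p_{A'}:\Gamma$ and $\Gamma.A\vdash\mathrm q_A=\mathrm q_{A'}:A[\mathrm p_A]$; if $\Gamma\vdash A=A'$, $\Delta\vdash\gamma=\gamma':\Gamma$, $\Delta\vdash a=a':A[\gamma]$ then $\Delta\vdash\langle\gamma,a\rangle_A=\langle\gamma',a'\rangle_{A'}:\Gamma.A$;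 if $\Gamma\vdash a=a':A$, $\Delta\vdash\gamma=\gamma':\Gamma$ then $\Delta\vdash a[\gamma]=a'[\gamma']:A[\gamma]$. *Conversion* (whenever the constituents are well-typed): $(\theta\circ\delta)\circ\gamma=\theta\circ(\delta\circ\gamma)$; $\gamma=\mathrm{id}\circ\gamma$; $\gamma=\gamma\circ\mathrm{id}$; $A[\gamma\circ\delta]=A[\gamma][\delta]$; $A[\mathrm{id}]=A$; $a[\gamma\circ\delta]=a[\gamma][\delta]$; $a[\mathrm{id}]=a$; $\gamma=\langle\rangle_\Gamma$ if $\Gamma\vdash\gamma:1$; $\mathrm p_A\circ\langle\gamma,a\rangle_A=\gamma$; $\mathrm q_A[\langle\gamma,a\rangle_A]=a$; $\gamma=\langle\mathrm p_A\circ\gamma,\mathrm q_A[\gamma]\rangle_A$ if $\Delta\vdash\gamma:\Gamma.A$. *Identity types*: if $\Gamma\vdash A=A'$, $\Gamma\vdash a=a':A$, $\Gamma\vdash b=b':A$ then $\Gamma\vdash\mathrm I(A,a,b)=\mathrm I(A',a',b')$; if $\Gamma\vdash a=a':A$ then $\Gamma\vdash\mathrm r(a)=\mathrm r(a'):\mathrm I(A,a,a')$; if $\Gamma\vdash c:\mathrm I(A,a,a')$ then $\Gamma\vdash a=a':A$ and $\Gamma\vdash c=\mathrm r(a):\mathrm I(A,a,a')$; $\mathrm I(A,a,a')[\gamma]=\mathrm I(A[\gamma],a[\gamma],a'[\gamma])$. *Unit type*: $1\vdash\mathrm N_1=\mathrm N_1$; $1\vdash 0_1=0_1:\mathrm N_1$;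 if $1\vdash a:\mathrm N_1$ then $1\vdash a=0_1:\mathrm N_1$. *$\Sigma$-types*, for $\Gamma\vdash A$, $\Gamma.A\vdash B$: all operations respect equality of all their arguments; typing $\Gamma\vdash\Sigma(A,B)$; $\Gamma\vdash\mathrm{pair}(A,B,a,b):\Sigma(A,B)$ for $\Gamma\vdash a:A$, $\Gamma\vdash b:B[\langle\mathrm{id}_\Gamma,a\rangle_A]$; for $\Gamma\vdash c:\Sigma(A,B)$, $\Gamma\vdash\mathrm{fst}(A,c):A$ and $\Gamma\vdash\mathrm{snd}(A,B,c):B[\langle\mathrm{id}_\Gamma,\mathrm{fst}(A,c)\rangle_A]$; equations $\mathrm{fst}(A,\mathrm{pair}(A,B,a,b))=a$, $\mathrm{snd}(A,B,\mathrm{pair}(A,B,a,b))=b$, $c=\mathrm{pair}(A,B,\mathrm{fst}(A,c),\mathrm{snd}(A,B,c))$; $\Sigma(A,B)[\gamma]=\Sigma(A[\gamma],B[\gamma^+])$, $\mathrm{fst}(A,c)[\gamma]=\mathrm{fst}(A[\gamma],c[\gamma])$, $\mathrm{snd}(A,B,c)[\gamma]=\mathrm{snd}(A[\gamma],B[\gamma^+],c[\gamma])$, $\mathrm{pair}(A,B,a,b)[\gamma]=\mathrm{pair}(A[\gamma],B[\gamma^+],a[\gamma],b[\gamma])$. *$\Pi$-types*, for $\Gamma\vdash A$, $\Gamma.A\vdash B$: all operations respect equality of all their arguments; typing $\Gamma\vdash\Pi(A,B)$; $\Gamma\vdash\lambda(A,b):\Pi(A,B)$ for $\Gamma.A\vdash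 b:B$; $\Gamma\vdash\mathrm{app}(A,B,c,a):B[\langle\mathrm{id}_\Gamma,a\rangle_A]$ for $\Gamma\vdash c:\Pi(A,B)$, $\Gamma\vdash a:A$; equations $\mathrm{app}(A,B,\lambda(A,b),a)=b[\langle\mathrm{id}_\Gamma,a\rangle_A]$, $\lambda(A,\mathrm{app}(A[\mathrm p_A],B[\mathrm p_A^+],c[\mathrm p_A],\mathrm q_A))=c$; $\Pi(A,B)[\gamma]=\Pi(A[\gamma],B[\gamma^+])$, $\lambda(A,b)[\gamma]=\lambda(A[\gamma],b[\gamma^+])$, $\mathrm{app}(A,B,c,a)[\gamma]=\mathrm{app}(A[\gamma],B[\gamma^+],c[\gamma],a[\gamma])$. **Category of contexts**: objects are raw contexts $\Gamma$ with $\Gamma\vdash$ derivable, modulo derivable equality $\Gamma=\Gamma'\vdash$; arrows $\Gamma\to\Delta$ are raw substitutions $\gamma$ with $\Gamma\vdash\gamma:\Delta$, modulo derivable equality. This category is the presentation of the bifree locally cartesian closed category on one object (the object being $1.o$) to which the theorem refers. *)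

theory Defs
  imports Main "HOL-Library.Nat_Bijection"
begin

text \<open>
  Annotations follow the named calculus: \<open>id\<close> and \<open>\<langle>\<rangle>\<close> carry a context, \<open>p\<close>, \<open>q\<close> and context
  extension pairing carry a type. \<open>SPair \<gamma> a A\<close> is the substitution \<open>\<langle>\<gamma>, a\<rangle>\<close> annotated with \<open>A\<close>.
\<close>

datatype ctx =
    Empty
  | Extend ctx ty  (infixl "\<triangleright>" 75)
and sub =
    SComp sub sub  (infixl "\<odot>" 80)
  | SId ctx  ("id\<^bsub>_\<^esub>")
  | STerminal ctx  ("\<langle>\<rangle>\<^bsub>_\<^esub>")
  | SProj ty  ("p\<^bsub>_\<^esub>")
  | SPair sub tm ty  ("\<langle>_, _\<rangle>\<^bsub>_\<^esub>")
and ty =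
    TBase
  | TSubst ty sub  ("_ [_]\<^sub>T" [100, 0] 100)
  | TId ty tm tm
  | TUnit
  | TSigma ty ty
  | TPi ty ty
and tm =
    Subst tm sub  ("_ [_]\<^sub>t" [100, 0] 100)
  | Var ty  ("q\<^bsub>_\<^esub>")
  | Refl tm
  | Star
  | Fst ty tm
  | Snd ty ty tm
  | MkPair ty ty tm tm
  | App ty ty tm tm
  | Lam ty tm

text \<open>The lifting \<open>\<gamma>\<^sup>+\<close>; it depends on the type \<open>A\<close> by which the contexts are extended.\<close>

abbreviation lift :: "ty \<Rightarrow> sub \<Rightarrow> sub" where
  "lift A \<gamma> \<equiv> \<langle>\<gamma> \<odot> p\<^bsub>A[\<gamma>]\<^sub>T\<^esub>, q\<^bsub>A[\<gamma>]\<^sub>T\<^esub>\<rangle>\<^bsub>A\<^esub>"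

text \<open>
  Well-formedness and typing are the reflexive instances of the four equality judgments, so each
  congruence rule is at the same time the typing rule of its operation. \<open>TBase\<close> and \<open>TUnit\<close> are
  types in the empty context only and reach other contexts by substitution; \<open>Empty \<triangleright> TBase\<close> is the
  generating object.
\<close>

inductive
  ctx_eq :: "ctx \<Rightarrow> ctx \<Rightarrow> bool"  ("\<turnstile>\<^sub>c _ \<approx> _" [51, 51] 50) and
  sub_eq :: "ctx \<Rightarrow> sub \<Rightarrow> sub \<Rightarrow> ctx \<Rightarrow> bool"  ("_ \<turnstile>\<^sub>s _ \<approx> _ : _" [51, 51, 51, 51] 50) and
  ty_eq :: "ctx \<Rightarrow> ty \<Rightarrow> ty \<Rightarrow> bool"  ("_ \<turnstile>\<^sub>T _ \<approx> _" [51, 51, 51] 50) and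
  tm_eq :: "ctx \<Rightarrow> tm \<Rightarrow> tm \<Rightarrow> ty \<Rightarrow> bool"  ("_ \<turnstile>\<^sub>t _ \<approx> _ : _" [51, 51, 51, 51] 50) and
  is_ctx :: "ctx \<Rightarrow> bool"  ("\<turnstile>\<^sub>c _" [51] 50) and
  is_sub :: "ctx \<Rightarrow> sub \<Rightarrow> ctx \<Rightarrow> bool"  ("_ \<turnstile>\<^sub>s _ : _" [51, 51, 51] 50) and
  is_ty :: "ctx \<Rightarrow> ty \<Rightarrow> bool"  ("_ \<turnstile>\<^sub>T _" [51, 51] 50) and
  is_tm :: "ctx \<Rightarrow> tm \<Rightarrow> ty \<Rightarrow> bool"  ("_ \<turnstile>\<^sub>t _ : _" [51, 51, 51] 50)
where
  "\<turnstile>\<^sub>c \<Gamma> \<equiv> \<turnstile>\<^sub>c \<Gamma> \<approx> \<Gamma>"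
| "\<Delta> \<turnstile>\<^sub>s \<gamma> : \<Gamma> \<equiv> \<Delta> \<turnstile>\<^sub>s \<gamma> \<approx> \<gamma> : \<Gamma>"
| "\<Gamma> \<turnstile>\<^sub>T A \<equiv> \<Gamma> \<turnstile>\<^sub>T A \<approx> A"
| "\<Gamma> \<turnstile>\<^sub>t a : A \<equiv> \<Gamma> \<turnstile>\<^sub>t a \<approx> a : A"
| ctx_sym: "\<turnstile>\<^sub>c \<Gamma> \<approx> \<Gamma>' \<Longrightarrow> \<turnstile>\<^sub>c \<Gamma>' \<approx> \<Gamma>"
| ctx_trans: "\<turnstile>\<^sub>c \<Gamma> \<approx> \<Gamma>' \<Longrightarrow> \<turnstile>\<^sub>c \<Gamma>' \<approx> \<Gamma>'' \<Longrightarrow> \<turnstile>\<^sub>c \<Gamma> \<approx> \<Gamma>''"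
| sub_sym: "\<Delta> \<turnstile>\<^sub>s \<gamma> \<approx> \<gamma>' : \<Gamma> \<Longrightarrow> \<Delta> \<turnstile>\<^sub>s \<gamma>' \<approx> \<gamma> : \<Gamma>"
| sub_trans: "\<Delta> \<turnstile>\<^sub>s \<gamma> \<approx> \<gamma>' : \<Gamma> \<Longrightarrow> \<Delta> \<turnstile>\<^sub>s \<gamma>' \<approx> \<gamma>'' : \<Gamma> \<Longrightarrow> \<Delta> \<turnstile>\<^sub>s \<gamma> \<approx> \<gamma>'' : \<Gamma>"
| ty_sym: "\<Gamma> \<turnstile>\<^sub>T A \<approx> A' \<Longrightarrow> \<Gamma> \<turnstile>\<^sub>T A' \<approx> A"
| ty_trans: "\<Gamma> \<turnstile>\<^sub>T A \<approx> A' \<Longrightarrow> \<Gamma> \<turnstile>\<^sub>T A' \<approx> A'' \<Longrightarrow> \<Gamma> \<turnstile>\<^sub>T A \<approx> A''"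
| tm_sym: "\<Gamma> \<turnstile>\<^sub>t a \<approx> a' : A \<Longrightarrow> \<Gamma> \<turnstile>\<^sub>t a' \<approx> a : A"
| tm_trans: "\<Gamma> \<turnstile>\<^sub>t a \<approx> a' : A \<Longrightarrow> \<Gamma> \<turnstile>\<^sub>t a' \<approx> a'' : A \<Longrightarrow> \<Gamma> \<turnstile>\<^sub>t a \<approx> a'' : A"
| sub_pres: "\<turnstile>\<^sub>c \<Gamma> \<approx> \<Gamma>' \<Longrightarrow> \<turnstile>\<^sub>c \<Delta> \<approx> \<Delta>' \<Longrightarrow> \<Gamma> \<turnstile>\<^sub>s \<gamma> \<approx> \<gamma>' : \<Delta> \<Longrightarrow> \<Gamma>' \<turnstile>\<^sub>s \<gamma> \<approx> \<gamma>' : \<Delta>'"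
| ty_pres: "\<turnstile>\<^sub>c \<Gamma> \<approx> \<Gamma>' \<Longrightarrow> \<Gamma> \<turnstile>\<^sub>T A \<approx> A' \<Longrightarrow> \<Gamma>' \<turnstile>\<^sub>T A \<approx> A'"
| tm_pres: "\<turnstile>\<^sub>c \<Gamma> \<approx> \<Gamma>' \<Longrightarrow> \<Gamma> \<turnstile>\<^sub>T A \<approx> A' \<Longrightarrow> \<Gamma> \<turnstile>\<^sub>t a \<approx> a' : A \<Longrightarrow> \<Gamma>' \<turnstile>\<^sub>t a \<approx> a' : A'"
| empty_cong: "\<turnstile>\<^sub>c Empty \<approx> Empty"
| base_cong: "Empty \<turnstile>\<^sub>T TBase \<approx> TBase"
| extend_cong: "\<turnstile>\<^sub>c \<Gamma> \<approx> \<Gamma>' \<Longrightarrow> \<Gamma> \<turnstile>\<^sub>T A \<approx> A' \<Longrightarrow> \<turnstile>\<^sub>c \<Gamma> \<triangleright> A \<approx> \<Gamma>' \<triangleright> A'"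
| ty_subst_cong: "\<Gamma> \<turnstile>\<^sub>T A \<approx> A' \<Longrightarrow> \<Delta> \<turnstile>\<^sub>s \<gamma> \<approx> \<gamma>' : \<Gamma> \<Longrightarrow> \<Delta> \<turnstile>\<^sub>T A[\<gamma>]\<^sub>T \<approx> A'[\<gamma>']\<^sub>T"
| id_cong: "\<turnstile>\<^sub>c \<Gamma> \<approx> \<Gamma>' \<Longrightarrow> \<Gamma> \<turnstile>\<^sub>s id\<^bsub>\<Gamma>\<^esub> \<approx> id\<^bsub>\<Gamma>'\<^esub> : \<Gamma>"
| terminal_cong: "\<turnstile>\<^sub>c \<Gamma> \<approx> \<Gamma>' \<Longrightarrow> \<Gamma> \<turnstile>\<^sub>s \<langle>\<rangle>\<^bsub>\<Gamma>\<^esub> \<approx> \<langle>\<rangle>\<^bsub>\<Gamma>'\<^esub> : Empty"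
| comp_cong: "\<Gamma> \<turnstile>\<^sub>s \<delta> \<approx> \<delta>' : \<Delta> \<Longrightarrow> \<Delta> \<turnstile>\<^sub>s \<gamma> \<approx> \<gamma>' : \<Theta> \<Longrightarrow> \<Gamma> \<turnstile>\<^sub>s \<gamma> \<odot> \<delta> \<approx> \<gamma>' \<odot> \<delta>' : \<Theta>"
| p_cong: "\<Gamma> \<turnstile>\<^sub>T A \<approx> A' \<Longrightarrow> \<Gamma> \<triangleright> A \<turnstile>\<^sub>s p\<^bsub>A\<^esub> \<approx> p\<^bsub>A'\<^esub> : \<Gamma>"
| q_cong: "\<Gamma> \<turnstile>\<^sub>T A \<approx> A' \<Longrightarrow> \<Gamma> \<triangleright> A \<turnstile>\<^sub>t q\<^bsub>A\<^esub> \<approx> q\<^bsub>A'\<^esub> : A[p\<^bsub>A\<^esub>]\<^sub>T"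
| spair_cong: "\<Gamma> \<turnstile>\<^sub>T A \<approx> A' \<Longrightarrow> \<Delta> \<turnstile>\<^sub>s \<gamma> \<approx> \<gamma>' : \<Gamma> \<Longrightarrow> \<Delta> \<turnstile>\<^sub>t a \<approx> a' : A[\<gamma>]\<^sub>T \<Longrightarrow>
    \<Delta> \<turnstile>\<^sub>s \<langle>\<gamma>, a\<rangle>\<^bsub>A\<^esub> \<approx> \<langle>\<gamma>', a'\<rangle>\<^bsub>A'\<^esub> : \<Gamma> \<triangleright> A"
| tm_subst_cong: "\<Gamma> \<turnstile>\<^sub>t a \<approx> a' : A \<Longrightarrow> \<Delta> \<turnstile>\<^sub>s \<gamma> \<approx> \<gamma>' : \<Gamma> \<Longrightarrow> \<Delta> \<turnstile>\<^sub>t a[\<gamma>]\<^sub>t \<approx> a'[\<gamma>']\<^sub>t : A[\<gamma>]\<^sub>T"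
| comp_assoc: "\<Delta> \<turnstile>\<^sub>s \<theta> : \<Theta> \<Longrightarrow> \<Gamma> \<turnstile>\<^sub>s \<delta> : \<Delta> \<Longrightarrow> \<Xi> \<turnstile>\<^sub>s \<gamma> : \<Gamma> \<Longrightarrow>
    \<Xi> \<turnstile>\<^sub>s (\<theta> \<odot> \<delta>) \<odot> \<gamma> \<approx> \<theta> \<odot> (\<delta> \<odot> \<gamma>) : \<Theta>"
| id_left: "\<Gamma> \<turnstile>\<^sub>s \<gamma> : \<Delta> \<Longrightarrow> \<Gamma> \<turnstile>\<^sub>s \<gamma> \<approx> id\<^bsub>\<Delta>\<^esub> \<odot> \<gamma> : \<Delta>"
| id_right: "\<Gamma> \<turnstile>\<^sub>s \<gamma> : \<Delta> \<Longrightarrow> \<Gamma> \<turnstile>\<^sub>s \<gamma> \<approx> \<gamma> \<odot> id\<^bsub>\<Gamma>\<^esub> : \<Delta>"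
| ty_subst_comp: "\<Gamma> \<turnstile>\<^sub>T A \<Longrightarrow> \<Delta> \<turnstile>\<^sub>s \<gamma> : \<Gamma> \<Longrightarrow> \<Theta> \<turnstile>\<^sub>s \<delta> : \<Delta> \<Longrightarrow>
    \<Theta> \<turnstile>\<^sub>T A[\<gamma> \<odot> \<delta>]\<^sub>T \<approx> A[\<gamma>]\<^sub>T[\<delta>]\<^sub>T"
| ty_subst_id: "\<Gamma> \<turnstile>\<^sub>T A \<Longrightarrow> \<Gamma> \<turnstile>\<^sub>T A[id\<^bsub>\<Gamma>\<^esub>]\<^sub>T \<approx> A"
| tm_subst_comp: "\<Gamma> \<turnstile>\<^sub>t a : A \<Longrightarrow> \<Delta> \<turnstile>\<^sub>s \<gamma> : \<Gamma> \<Longrightarrow> \<Theta> \<turnstile>\<^sub>s \<delta> : \<Delta> \<Longrightarrow>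
    \<Theta> \<turnstile>\<^sub>t a[\<gamma> \<odot> \<delta>]\<^sub>t \<approx> a[\<gamma>]\<^sub>t[\<delta>]\<^sub>t : A[\<gamma> \<odot> \<delta>]\<^sub>T"
| tm_subst_id: "\<Gamma> \<turnstile>\<^sub>t a : A \<Longrightarrow> \<Gamma> \<turnstile>\<^sub>t a[id\<^bsub>\<Gamma>\<^esub>]\<^sub>t \<approx> a : A"
| terminal_eta: "\<Gamma> \<turnstile>\<^sub>s \<gamma> : Empty \<Longrightarrow> \<Gamma> \<turnstile>\<^sub>s \<gamma> \<approx> \<langle>\<rangle>\<^bsub>\<Gamma>\<^esub> : Empty"
| p_spair: "\<Gamma> \<turnstile>\<^sub>T A \<Longrightarrow> \<Delta> \<turnstile>\<^sub>s \<gamma> : \<Gamma> \<Longrightarrow> \<Delta> \<turnstile>\<^sub>t a : A[\<gamma>]\<^sub>T \<Longrightarrow>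
    \<Delta> \<turnstile>\<^sub>s p\<^bsub>A\<^esub> \<odot> \<langle>\<gamma>, a\<rangle>\<^bsub>A\<^esub> \<approx> \<gamma> : \<Gamma>"
| q_spair: "\<Gamma> \<turnstile>\<^sub>T A \<Longrightarrow> \<Delta> \<turnstile>\<^sub>s \<gamma> : \<Gamma> \<Longrightarrow> \<Delta> \<turnstile>\<^sub>t a : A[\<gamma>]\<^sub>T \<Longrightarrow>
    \<Delta> \<turnstile>\<^sub>t q\<^bsub>A\<^esub>[\<langle>\<gamma>, a\<rangle>\<^bsub>A\<^esub>]\<^sub>t \<approx> a : A[\<gamma>]\<^sub>T"
| spair_eta: "\<Gamma> \<turnstile>\<^sub>T A \<Longrightarrow> \<Delta> \<turnstile>\<^sub>s \<gamma> : \<Gamma> \<triangleright> A \<Longrightarrow>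
    \<Delta> \<turnstile>\<^sub>s \<gamma> \<approx> \<langle>p\<^bsub>A\<^esub> \<odot> \<gamma>, q\<^bsub>A\<^esub>[\<gamma>]\<^sub>t\<rangle>\<^bsub>A\<^esub> : \<Gamma> \<triangleright> A"
| I_cong: "\<Gamma> \<turnstile>\<^sub>T A \<approx> A' \<Longrightarrow> \<Gamma> \<turnstile>\<^sub>t a \<approx> a' : A \<Longrightarrow> \<Gamma> \<turnstile>\<^sub>t b \<approx> b' : A \<Longrightarrow>
    \<Gamma> \<turnstile>\<^sub>T TId A a b \<approx> TId A' a' b'"
| refl_cong: "\<Gamma> \<turnstile>\<^sub>t a \<approx> a' : A \<Longrightarrow> \<Gamma> \<turnstile>\<^sub>t Refl a \<approx> Refl a' : TId A a a'"
| reflection: "\<Gamma> \<turnstile>\<^sub>t c : TId A a a' \<Longrightarrow> \<Gamma> \<turnstile>\<^sub>t a \<approx> a' : A"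
| I_eta: "\<Gamma> \<turnstile>\<^sub>t c : TId A a a' \<Longrightarrow> \<Gamma> \<turnstile>\<^sub>t c \<approx> Refl a : TId A a a'"
| I_subst: "\<Gamma> \<turnstile>\<^sub>T A \<Longrightarrow> \<Gamma> \<turnstile>\<^sub>t a : A \<Longrightarrow> \<Gamma> \<turnstile>\<^sub>t a' : A \<Longrightarrow> \<Delta> \<turnstile>\<^sub>s \<gamma> : \<Gamma> \<Longrightarrow>
    \<Delta> \<turnstile>\<^sub>T (TId A a a')[\<gamma>]\<^sub>T \<approx> TId (A[\<gamma>]\<^sub>T) (a[\<gamma>]\<^sub>t) (a'[\<gamma>]\<^sub>t)"
| unit_cong: "Empty \<turnstile>\<^sub>T TUnit \<approx> TUnit"
| star_cong: "Empty \<turnstile>\<^sub>t Star \<approx> Star : TUnit"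
| unit_eta: "Empty \<turnstile>\<^sub>t a : TUnit \<Longrightarrow> Empty \<turnstile>\<^sub>t a \<approx> Star : TUnit"
| Sigma_cong: "\<Gamma> \<turnstile>\<^sub>T A \<approx> A' \<Longrightarrow> \<Gamma> \<triangleright> A \<turnstile>\<^sub>T B \<approx> B' \<Longrightarrow> \<Gamma> \<turnstile>\<^sub>T TSigma A B \<approx> TSigma A' B'"
| pair_cong: "\<Gamma> \<turnstile>\<^sub>T A \<approx> A' \<Longrightarrow> \<Gamma> \<triangleright> A \<turnstile>\<^sub>T B \<approx> B' \<Longrightarrow>
    \<Gamma> \<turnstile>\<^sub>t a \<approx> a' : A \<Longrightarrow> \<Gamma> \<turnstile>\<^sub>t b \<approx> b' : B[\<langle>id\<^bsub>\<Gamma>\<^esub>, a\<rangle>\<^bsub>A\<^esub>]\<^sub>T \<Longrightarrow>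
    \<Gamma> \<turnstile>\<^sub>t MkPair A B a b \<approx> MkPair A' B' a' b' : TSigma A B"
| fst_cong: "\<Gamma> \<turnstile>\<^sub>T A \<approx> A' \<Longrightarrow> \<Gamma> \<triangleright> A \<turnstile>\<^sub>T B \<Longrightarrow> \<Gamma> \<turnstile>\<^sub>t c \<approx> c' : TSigma A B \<Longrightarrow>
    \<Gamma> \<turnstile>\<^sub>t Fst A c \<approx> Fst A' c' : A"
| snd_cong: "\<Gamma> \<turnstile>\<^sub>T A \<approx> A' \<Longrightarrow> \<Gamma> \<triangleright> A \<turnstile>\<^sub>T B \<approx> B' \<Longrightarrow> \<Gamma> \<turnstile>\<^sub>t c \<approx> c' : TSigma A B \<Longrightarrow>
    \<Gamma> \<turnstile>\<^sub>t Snd A B c \<approx> Snd A' B' c' : B[\<langle>id\<^bsub>\<Gamma>\<^esub>, Fst A c\<rangle>\<^bsub>A\<^esub>]\<^sub>T"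
| fst_beta: "\<Gamma> \<turnstile>\<^sub>T A \<Longrightarrow> \<Gamma> \<triangleright> A \<turnstile>\<^sub>T B \<Longrightarrow> \<Gamma> \<turnstile>\<^sub>t a : A \<Longrightarrow> \<Gamma> \<turnstile>\<^sub>t b : B[\<langle>id\<^bsub>\<Gamma>\<^esub>, a\<rangle>\<^bsub>A\<^esub>]\<^sub>T \<Longrightarrow>
    \<Gamma> \<turnstile>\<^sub>t Fst A (MkPair A B a b) \<approx> a : A"
| snd_beta: "\<Gamma> \<turnstile>\<^sub>T A \<Longrightarrow> \<Gamma> \<triangleright> A \<turnstile>\<^sub>T B \<Longrightarrow> \<Gamma> \<turnstile>\<^sub>t a : A \<Longrightarrow> \<Gamma> \<turnstile>\<^sub>t b : B[\<langle>id\<^bsub>\<Gamma>\<^esub>, a\<rangle>\<^bsub>A\<^esub>]\<^sub>T \<Longrightarrow>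
    \<Gamma> \<turnstile>\<^sub>t Snd A B (MkPair A B a b) \<approx> b : B[\<langle>id\<^bsub>\<Gamma>\<^esub>, a\<rangle>\<^bsub>A\<^esub>]\<^sub>T"
| Sigma_eta: "\<Gamma> \<turnstile>\<^sub>T A \<Longrightarrow> \<Gamma> \<triangleright> A \<turnstile>\<^sub>T B \<Longrightarrow> \<Gamma> \<turnstile>\<^sub>t c : TSigma A B \<Longrightarrow>
    \<Gamma> \<turnstile>\<^sub>t c \<approx> MkPair A B (Fst A c) (Snd A B c) : TSigma A B"
| Sigma_subst: "\<Gamma> \<turnstile>\<^sub>T A \<Longrightarrow> \<Gamma> \<triangleright> A \<turnstile>\<^sub>T B \<Longrightarrow> \<Delta> \<turnstile>\<^sub>s \<gamma> : \<Gamma> \<Longrightarrow>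
    \<Delta> \<turnstile>\<^sub>T (TSigma A B)[\<gamma>]\<^sub>T \<approx> TSigma (A[\<gamma>]\<^sub>T) (B[lift A \<gamma>]\<^sub>T)"
| fst_subst: "\<Gamma> \<turnstile>\<^sub>T A \<Longrightarrow> \<Gamma> \<triangleright> A \<turnstile>\<^sub>T B \<Longrightarrow> \<Gamma> \<turnstile>\<^sub>t c : TSigma A B \<Longrightarrow> \<Delta> \<turnstile>\<^sub>s \<gamma> : \<Gamma> \<Longrightarrow>
    \<Delta> \<turnstile>\<^sub>t (Fst A c)[\<gamma>]\<^sub>t \<approx> Fst (A[\<gamma>]\<^sub>T) (c[\<gamma>]\<^sub>t) : A[\<gamma>]\<^sub>T"
| snd_subst: "\<Gamma> \<turnstile>\<^sub>T A \<Longrightarrow> \<Gamma> \<triangleright> A \<turnstile>\<^sub>T B \<Longrightarrow> \<Gamma> \<turnstile>\<^sub>t c : TSigma A B \<Longrightarrow> \<Delta> \<turnstile>\<^sub>s \<gamma> : \<Gamma> \<Longrightarrow>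
    \<Delta> \<turnstile>\<^sub>t (Snd A B c)[\<gamma>]\<^sub>t \<approx> Snd (A[\<gamma>]\<^sub>T) (B[lift A \<gamma>]\<^sub>T) (c[\<gamma>]\<^sub>t)
      : B[\<langle>id\<^bsub>\<Gamma>\<^esub>, Fst A c\<rangle>\<^bsub>A\<^esub>]\<^sub>T[\<gamma>]\<^sub>T"
| pair_subst: "\<Gamma> \<turnstile>\<^sub>T A \<Longrightarrow> \<Gamma> \<triangleright> A \<turnstile>\<^sub>T B \<Longrightarrow> \<Gamma> \<turnstile>\<^sub>t a : A \<Longrightarrow> \<Gamma> \<turnstile>\<^sub>t b : B[\<langle>id\<^bsub>\<Gamma>\<^esub>, a\<rangle>\<^bsub>A\<^esub>]\<^sub>T \<Longrightarrow>
    \<Delta> \<turnstile>\<^sub>s \<gamma> : \<Gamma> \<Longrightarrow>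
    \<Delta> \<turnstile>\<^sub>t (MkPair A B a b)[\<gamma>]\<^sub>t \<approx> MkPair (A[\<gamma>]\<^sub>T) (B[lift A \<gamma>]\<^sub>T) (a[\<gamma>]\<^sub>t) (b[\<gamma>]\<^sub>t)
      : (TSigma A B)[\<gamma>]\<^sub>T"
| Pi_cong: "\<Gamma> \<turnstile>\<^sub>T A \<approx> A' \<Longrightarrow> \<Gamma> \<triangleright> A \<turnstile>\<^sub>T B \<approx> B' \<Longrightarrow> \<Gamma> \<turnstile>\<^sub>T TPi A B \<approx> TPi A' B'"
| lam_cong: "\<Gamma> \<turnstile>\<^sub>T A \<approx> A' \<Longrightarrow> \<Gamma> \<triangleright> A \<turnstile>\<^sub>T B \<Longrightarrow> \<Gamma> \<triangleright> A \<turnstile>\<^sub>t b \<approx> b' : B \<Longrightarrow>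
    \<Gamma> \<turnstile>\<^sub>t Lam A b \<approx> Lam A' b' : TPi A B"
| app_cong: "\<Gamma> \<turnstile>\<^sub>T A \<approx> A' \<Longrightarrow> \<Gamma> \<triangleright> A \<turnstile>\<^sub>T B \<approx> B' \<Longrightarrow>
    \<Gamma> \<turnstile>\<^sub>t c \<approx> c' : TPi A B \<Longrightarrow> \<Gamma> \<turnstile>\<^sub>t a \<approx> a' : A \<Longrightarrow>
    \<Gamma> \<turnstile>\<^sub>t App A B c a \<approx> App A' B' c' a' : B[\<langle>id\<^bsub>\<Gamma>\<^esub>, a\<rangle>\<^bsub>A\<^esub>]\<^sub>T"
| Pi_beta: "\<Gamma> \<turnstile>\<^sub>T A \<Longrightarrow> \<Gamma> \<triangleright> A \<turnstile>\<^sub>T B \<Longrightarrow> \<Gamma> \<triangleright> A \<turnstile>\<^sub>t b : B \<Longrightarrow> \<Gamma> \<turnstile>\<^sub>t a : A \<Longrightarrow>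
    \<Gamma> \<turnstile>\<^sub>t App A B (Lam A b) a \<approx> b[\<langle>id\<^bsub>\<Gamma>\<^esub>, a\<rangle>\<^bsub>A\<^esub>]\<^sub>t : B[\<langle>id\<^bsub>\<Gamma>\<^esub>, a\<rangle>\<^bsub>A\<^esub>]\<^sub>T"
| Pi_eta: "\<Gamma> \<turnstile>\<^sub>T A \<Longrightarrow> \<Gamma> \<triangleright> A \<turnstile>\<^sub>T B \<Longrightarrow> \<Gamma> \<turnstile>\<^sub>t c : TPi A B \<Longrightarrow>
    \<Gamma> \<turnstile>\<^sub>t Lam A (App (A[p\<^bsub>A\<^esub>]\<^sub>T) (B[lift A p\<^bsub>A\<^esub>]\<^sub>T) (c[p\<^bsub>A\<^esub>]\<^sub>t) q\<^bsub>A\<^esub>) \<approx> c : TPi A B"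
| Pi_subst: "\<Gamma> \<turnstile>\<^sub>T A \<Longrightarrow> \<Gamma> \<triangleright> A \<turnstile>\<^sub>T B \<Longrightarrow> \<Delta> \<turnstile>\<^sub>s \<gamma> : \<Gamma> \<Longrightarrow>
    \<Delta> \<turnstile>\<^sub>T (TPi A B)[\<gamma>]\<^sub>T \<approx> TPi (A[\<gamma>]\<^sub>T) (B[lift A \<gamma>]\<^sub>T)"
| lam_subst: "\<Gamma> \<turnstile>\<^sub>T A \<Longrightarrow> \<Gamma> \<triangleright> A \<turnstile>\<^sub>T B \<Longrightarrow> \<Gamma> \<triangleright> A \<turnstile>\<^sub>t b : B \<Longrightarrow> \<Delta> \<turnstile>\<^sub>s \<gamma> : \<Gamma> \<Longrightarrow>
    \<Delta> \<turnstile>\<^sub>t (Lam A b)[\<gamma>]\<^sub>t \<approx> Lam (A[\<gamma>]\<^sub>T) (b[lift A \<gamma>]\<^sub>t) : (TPi A B)[\<gamma>]\<^sub>T"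
| app_subst: "\<Gamma> \<turnstile>\<^sub>T A \<Longrightarrow> \<Gamma> \<triangleright> A \<turnstile>\<^sub>T B \<Longrightarrow> \<Gamma> \<turnstile>\<^sub>t c : TPi A B \<Longrightarrow> \<Gamma> \<turnstile>\<^sub>t a : A \<Longrightarrow> \<Delta> \<turnstile>\<^sub>s \<gamma> : \<Gamma> \<Longrightarrow>
    \<Delta> \<turnstile>\<^sub>t (App A B c a)[\<gamma>]\<^sub>t \<approx> App (A[\<gamma>]\<^sub>T) (B[lift A \<gamma>]\<^sub>T) (c[\<gamma>]\<^sub>t) (a[\<gamma>]\<^sub>t)
      : B[\<langle>id\<^bsub>\<Gamma>\<^esub>, a\<rangle>\<^bsub>A\<^esub>]\<^sub>T[\<gamma>]\<^sub>T"

text \<open>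
  In the category of contexts the arrow denoted by \<open>\<Gamma> \<turnstile>\<^sub>s \<gamma> : \<Delta>\<close> is its class under derivable
  equality. This class depends on \<open>\<Gamma>\<close> and \<open>\<Delta>\<close> only through the objects they represent, and
  equality of arrows is derivability of the equality judgment.
\<close>

definition arrow :: "ctx \<Rightarrow> ctx \<Rightarrow> sub \<Rightarrow> sub set" where
  "arrow \<Gamma> \<Delta> \<gamma> = {\<gamma>'. \<Gamma> \<turnstile>\<^sub>s \<gamma> \<approx> \<gamma>' : \<Delta>}"

lemma arrow_eq_iff:
  assumes "\<Gamma> \<turnstile>\<^sub>s \<gamma> : \<Delta>" "\<Gamma> \<turnstile>\<^sub>s \<gamma>' : \<Delta>"
  shows "arrow \<Gamma> \<Delta> \<gamma> = arrow \<Gamma> \<Delta> \<gamma>' \<longleftrightarrow> \<Gamma> \<turnstile>\<^sub>s \<gamma> \<approx> \<gamma>' : \<Delta>"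
  using assms unfolding arrow_def by (blast intro: sub_sym sub_trans)

lemma arrow_ctx_cong:
  assumes "\<turnstile>\<^sub>c \<Gamma> \<approx> \<Gamma>'" "\<turnstile>\<^sub>c \<Delta> \<approx> \<Delta>'"
  shows "arrow \<Gamma> \<Delta> \<gamma> = arrow \<Gamma>' \<Delta>' \<gamma>"
  using assms unfolding arrow_def by (blast intro: ctx_sym sub_pres)

primrec code_ctx :: "ctx \<Rightarrow> nat" and code_sub :: "sub \<Rightarrow> nat"
  and code_ty :: "ty \<Rightarrow> nat" and code_tm :: "tm \<Rightarrow> nat" where
  "code_ctx Empty = list_encode [0]"
| "code_ctx (\<Gamma> \<triangleright> A) = list_encode [1, code_ctx \<Gamma>, code_ty A]"
| "code_sub (\<gamma> \<odot> \<delta>) = list_encode [0, code_sub \<gamma>, code_sub \<delta>]"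
| "code_sub id\<^bsub>\<Gamma>\<^esub> = list_encode [1, code_ctx \<Gamma>]"
| "code_sub \<langle>\<rangle>\<^bsub>\<Gamma>\<^esub> = list_encode [2, code_ctx \<Gamma>]"
| "code_sub p\<^bsub>A\<^esub> = list_encode [3, code_ty A]"
| "code_sub \<langle>\<gamma>, a\<rangle>\<^bsub>A\<^esub> = list_encode [4, code_sub \<gamma>, code_tm a, code_ty A]"
| "code_ty TBase = list_encode [0]"
| "code_ty (A[\<gamma>]\<^sub>T) = list_encode [1, code_ty A, code_sub \<gamma>]"
| "code_ty (TId A a b) = list_encode [2, code_ty A, code_tm a, code_tm b]"
| "code_ty TUnit = list_encode [3]"
| "code_ty (TSigma A B) = list_encode [4, code_ty A, code_ty B]"
| "code_ty (TPi A B) = list_encode [5, code_ty A, code_ty B]"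
| "code_tm (a[\<gamma>]\<^sub>t) = list_encode [0, code_tm a, code_sub \<gamma>]"
| "code_tm q\<^bsub>A\<^esub> = list_encode [1, code_ty A]"
| "code_tm (Refl a) = list_encode [2, code_tm a]"
| "code_tm Star = list_encode [3]"
| "code_tm (Fst A c) = list_encode [4, code_ty A, code_tm c]"
| "code_tm (Snd A B c) = list_encode [5, code_ty A, code_ty B, code_tm c]"
| "code_tm (MkPair A B a b) = list_encode [6, code_ty A, code_ty B, code_tm a, code_tm b]"
| "code_tm (App A B c a) = list_encode [7, code_ty A, code_ty B, code_tm c, code_tm a]"
| "code_tm (Lam A b) = list_encode [8, code_ty A, code_tm b]"

lemma code_inject:
  "code_ctx \<Gamma> = code_ctx \<Gamma>' \<longleftrightarrow> \<Gamma> = \<Gamma>'"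
  "code_sub \<gamma> = code_sub \<gamma>' \<longleftrightarrow> \<gamma> = \<gamma>'"
  "code_ty A = code_ty A' \<longleftrightarrow> A = A'"
  "code_tm a = code_tm a' \<longleftrightarrow> a = a'"
  apply (induction \<Gamma> and \<gamma> and A and a arbitrary: \<Gamma>' and \<gamma>' and A' and a')
  subgoal for y by (cases y) (simp_all add: list_encode_eq del: list_encode.simps)
  subgoal for u v y by (cases y) (simp_all add: list_encode_eq del: list_encode.simps)
  subgoal for u v y by (cases y) (simp_all add: list_encode_eq del: list_encode.simps)
  subgoal for u y by (cases y) (simp_all add: list_encode_eq del: list_encode.simps)
  subgoal for u y by (cases y) (simp_all add: list_encode_eq del: list_encode.simps)
  subgoal for u y by (cases y) (simp_all add: list_encode_eq del: list_encode.simps)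
  subgoal for u v w y by (cases y) (simp_all add: list_encode_eq del: list_encode.simps)
  subgoal for y by (cases y) (simp_all add: list_encode_eq del: list_encode.simps)
  subgoal for u v y by (cases y) (simp_all add: list_encode_eq del: list_encode.simps)
  subgoal for u v w y by (cases y) (simp_all add: list_encode_eq del: list_encode.simps)
  subgoal for y by (cases y) (simp_all add: list_encode_eq del: list_encode.simps)
  subgoal for u v y by (cases y) (simp_all add: list_encode_eq del: list_encode.simps)
  subgoal for u v y by (cases y) (simp_all add: list_encode_eq del: list_encode.simps)
  subgoal for u v y by (cases y) (simp_all add: list_encode_eq del: list_encode.simps)
  subgoal for u y by (cases y) (simp_all add: list_encode_eq del: list_encode.simps)
  subgoal for u y by (cases y) (simp_all add: list_encode_eq del: list_encode.simps)
  subgoal for y by (cases y) (simp_all add: list_encode_eq del: list_encode.simps)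
  subgoal for u v y by (cases y) (simp_all add: list_encode_eq del: list_encode.simps)
  subgoal for u v w y by (cases y) (simp_all add: list_encode_eq del: list_encode.simps)
  subgoal for u v w x y by (cases y) (simp_all add: list_encode_eq del: list_encode.simps)
  subgoal for u v w x y by (cases y) (simp_all add: list_encode_eq del: list_encode.simps)
  subgoal for u v y by (cases y) (simp_all add: list_encode_eq del: list_encode.simps)
  done

text \<open>
  Arities are left implicit: \<open>computes f xs y\<close> says that the program \<open>f\<close>, run on the argument tuple
  \<open>xs\<close>, halts with result \<open>y\<close>. \<open>RProj i\<close> is 0-based, recursion is on the first argument, and in
  \<open>RMu f\<close> the minimised variable is the first argument of \<open>f\<close>; minimisation requires \<open>f\<close> to halt
  with a positive result on all smaller values.
\<close>

datatype recf =
    RZero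
  | RSuc
  | RProj nat
  | RComp recf "recf list"
  | RPrim recf recf
  | RMu recf

inductive computes :: "recf \<Rightarrow> nat list \<Rightarrow> nat \<Rightarrow> bool" where
  zero: "computes RZero xs 0"
| suc: "computes RSuc [x] (Suc x)"
| proj: "i < length xs \<Longrightarrow> computes (RProj i) xs (xs ! i)"
| comp: "list_all2 (\<lambda>g y. computes g xs y) gs ys \<Longrightarrow> computes f ys z \<Longrightarrow>
    computes (RComp f gs) xs z"
| prim_0: "computes f xs y \<Longrightarrow> computes (RPrim f g) (0 # xs) y"
| prim_Suc: "computes (RPrim f g) (n # xs) y \<Longrightarrow> computes g (n # y # xs) z \<Longrightarrow>
    computes (RPrim f g) (Suc n # xs) z"
| mu: "computes f (n # xs) 0 \<Longrightarrow> (\<forall>m<n. \<exists>y. computes f (m # xs) (Suc y)) \<Longrightarrow>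
    computes (RMu f) xs n"

lemma computes_deterministic: "computes f xs y \<Longrightarrow> computes f xs z \<Longrightarrow> y = z"
proof (induction arbitrary: z rule: computes.induct)
  case (comp xs gs ys f z')
  from comp.prems obtain ys' where ys': "list_all2 (\<lambda>g y. computes g xs y) gs ys'"
    and "computes f ys' z"
    by cases auto
  have "ys = ys'"
    using comp.IH(1) ys' by (auto simp: list_all2_conv_all_nth intro!: nth_equalityI)
  with comp.IH(2) \<open>computes f ys' z\<close> show ?case by simp
next
  case (prim_Suc f g n xs y z')
  from prim_Suc.prems obtain y' where "computes (RPrim f g) (n # xs) y'"
    and "computes g (n # y' # xs) z"
    by cases auto
  with prim_Suc.IH show ?case by blast
next
  case (mu f n xs)
  from mu.prems have z0: "computes f (z # xs) 0"
    and z: "\<forall>m<z. \<exists>y. computes f (m # xs) (Suc y)"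
    by (cases, simp)+
  have "\<not> n < z" using mu.IH(1) z by fastforce
  moreover have "\<not> z < n" using mu.IH(2) z0 by fastforce
  ultimately show ?case by simp
next
  case (prim_0 f xs y g)
  from prim_0.prems have "computes f xs z" by cases auto
  with prim_0.IH show ?case by blast
next
  case (zero xs)
  then show ?case by cases auto
next
  case (suc x)
  then show ?case by cases auto
next
  case (proj i xs)
  from proj.prems show ?case by cases auto
qed

end

theory Submission
  imports Defs
begin

text \<open>
  In a context declaring a binary operation on the generating object, two constants and proofs of the
  two laws of combinatory logic, closed combinatory terms become terms of type \<open>o\<close>, and convertible
  terms become equal because identity types are extensional. Conversely, the calculus has a model whose
  types are partial equivalence relations on the algebra of combinatory terms modulo conversion: \<open>o\<close> is
  interpreted by equality, and every operation of the calculus is realised by a combinator. Hence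
  equality of these arrows is exactly convertibility of combinatory terms. A decision
  procedure would be represented by a combinatory term; applying a suitable such term to its own
  code refutes it, since codes of applications and numerals are primitive recursive.
\<close>

section \<open>Combinatory logic\<close>

text \<open>Conversion in combinatory logic enters as hypotheses: the operation, \<open>K\<close>,
  \<open>S\<close> and proofs of the laws are variables of one fixed context, and reflection turns
  the law variables into equality judgments. The converse, that nothing else becomes equal, is where
  the work lies. The algebra of combinators is neither extensional nor equipped with surjective
  pairing, so the eta rules fail if equal terms must denote equal combinators. With partial
  equivalence relations they only have to denote related ones, and the relation on the generating
  type, being equality, still separates inconvertible terms. A decision procedure halts on every
  well-typed input, so representing halting runs is enough; divergence is never discussed. One of
  the two compared arrows can be kept fixed at \<open>K\<close>, which is also the numeral 0, so the
  diagonal term converts to 0 exactly when the procedure makes it 1. The contradiction needs two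
  distinct numerals, hence consistency; a graph model gives this without a confluence proof.\<close>

datatype cl = CK | CS | CApp cl cl

inductive cl_eq :: "cl \<Rightarrow> cl \<Rightarrow> bool" where
  refl: "cl_eq t t"
| sym: "cl_eq t u \<Longrightarrow> cl_eq u t"
| trans: "cl_eq t u \<Longrightarrow> cl_eq u v \<Longrightarrow> cl_eq t v"
| app: "cl_eq t t' \<Longrightarrow> cl_eq u u' \<Longrightarrow> cl_eq (CApp t u) (CApp t' u')"
| K: "cl_eq (CApp (CApp CK t) u) t"
| S: "cl_eq (CApp (CApp (CApp CS t) u) v) (CApp (CApp t v) (CApp u v))"

quotient_type comb = cl / cl_eq
  by (intro equivpI reflpI sympI transpI) (auto intro: cl_eq.intros)

lift_definition ap :: "comb \<Rightarrow> comb \<Rightarrow> comb"  (infixl "\<cdot>" 90) is CApp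
  by (rule cl_eq.app)
lift_definition cK :: comb is CK .
lift_definition cS :: comb is CS .

lemma cK [simp]: "cK \<cdot> x \<cdot> y = x"
  by transfer (rule cl_eq.K)

lemma cS [simp]: "cS \<cdot> x \<cdot> y \<cdot> z = x \<cdot> z \<cdot> (y \<cdot> z)"
  by transfer (rule cl_eq.S)

section \<open>Derived combinators: composition, exchange, pairing, currying, fixed points\<close>

definition "cI = cS \<cdot> cK \<cdot> cK"
definition "cB = cS \<cdot> (cK \<cdot> cS) \<cdot> cK"
definition "cC = cS \<cdot> (cB \<cdot> cB \<cdot> cS) \<cdot> (cK \<cdot> cK)"
text \<open>The Church pair, which sends \<open>f\<close> to \<open>f \<cdot> x \<cdot> y\<close>;
  the projections apply a pair to a selector.\<close>

definition "cPair = cB \<cdot> cC \<cdot> (cC \<cdot> cI)"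
definition "cFst = cC \<cdot> cI \<cdot> cK"
definition "cSnd = cC \<cdot> cI \<cdot> (cK \<cdot> cI)"
definition "cCurry = cC \<cdot> (cB \<cdot> cB \<cdot> cB) \<cdot> cPair"
definition "cSpair f g = cS \<cdot> (cB \<cdot> cPair \<cdot> f) \<cdot> g"

lemma cI [simp]: "cI \<cdot> x = x" by (simp add: cI_def)
lemma cB [simp]: "cB \<cdot> f \<cdot> g \<cdot> x = f \<cdot> (g \<cdot> x)" by (simp add: cB_def)
lemma cC [simp]: "cC \<cdot> f \<cdot> x \<cdot> y = f \<cdot> y \<cdot> x" by (simp add: cC_def)
lemma cFst [simp]: "cFst \<cdot> (cPair \<cdot> x \<cdot> y) = x" by (simp add: cFst_def cPair_def)
lemma cSnd [simp]: "cSnd \<cdot> (cPair \<cdot> x \<cdot> y) = y" by (simp add: cSnd_def cPair_def)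
lemma cCurry [simp]: "cCurry \<cdot> f \<cdot> x \<cdot> y = f \<cdot> (cPair \<cdot> x \<cdot> y)" by (simp add: cCurry_def)
lemma cSpair [simp]: "cSpair f g \<cdot> x = cPair \<cdot> (f \<cdot> x) \<cdot> (g \<cdot> x)" by (simp add: cSpair_def)

text \<open>Since \<open>cS \<cdot> cI \<cdot> cI\<close> is self-application,
  \<open>w \<cdot> x = f \<cdot> (x \<cdot> x)\<close>, and \<open>w \<cdot> w\<close> is the fixed
  point.\<close>

lemma fixpoint: "\<exists>x. x = f \<cdot> x"
proof -
  define w where "w = cS \<cdot> (cK \<cdot> f) \<cdot> (cS \<cdot> cI \<cdot> cI)"
  have "w \<cdot> x = f \<cdot> (x \<cdot> x)" for x by (simp add: w_def)
  then show ?thesis by blast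
qed

text \<open>Engeler's graph model shows that combinatory logic is consistent.\<close>

datatype graph = Atom | Arrow "graph list" graph

definition gapp :: "graph set \<Rightarrow> graph set \<Rightarrow> graph set" where
  "gapp X Y = {m. \<exists>ys. set ys \<subseteq> Y \<and> Arrow ys m \<in> X}"

text \<open>Tokens of a continuous map: finite pieces of the inputs together with an output that
  they already guarantee. \<open>gK\<close> describes the first projection, \<open>gS\<close> the
  map from \<open>X\<close>, \<open>Y\<close>, \<open>Z\<close> to \<open>X Z (Y Z)\<close>.\<close>

definition "gK = {Arrow xs (Arrow ys m) | xs ys m. m \<in> set xs}"
definition "gS = {Arrow xs (Arrow ys (Arrow zs m)) | xs ys zs m.
  m \<in> gapp (gapp (set xs) (set zs)) (gapp (set ys) (set zs))}"

lemma gappI: "set ys \<subseteq> Y \<Longrightarrow> Arrow ys m \<in> X \<Longrightarrow> m \<in> gapp X Y"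
  unfolding gapp_def by blast

lemma gappE:
  assumes "m \<in> gapp X Y"
  obtains ys where "set ys \<subseteq> Y" "Arrow ys m \<in> X"
  using assms unfolding gapp_def by blast

lemma gapp_mono: "X \<subseteq> X' \<Longrightarrow> Y \<subseteq> Y' \<Longrightarrow> gapp X Y \<subseteq> gapp X' Y'"
  unfolding gapp_def by blast

lemma gK: "gapp (gapp gK X) Y = X"
proof (intro set_eqI iffI)
  fix m assume "m \<in> X"
  then have "set [m] \<subseteq> X" "set [] \<subseteq> Y" "Arrow [m] (Arrow [] m) \<in> gK" by (auto simp: gK_def)
  then show "m \<in> gapp (gapp gK X) Y" unfolding gapp_def by blast
qed (auto simp: gapp_def gK_def)

text \<open>Continuity of application: finitely many output tokens use finitely many input tokens.
  It supplies the finite lists that a token of \<open>gS\<close> must contain.\<close>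

lemma gapp_finite:
  assumes "set ms \<subseteq> gapp X Y"
  shows "\<exists>xs ys. set xs \<subseteq> X \<and> set ys \<subseteq> Y \<and> set ms \<subseteq> gapp (set xs) (set ys)"
  using assms
proof (induction ms)
  case Nil
  show ?case by (rule exI[of _ "[]"], rule exI[of _ "[]"]) simp
next
  case (Cons m ms)
  then obtain xs ys where 1: "set xs \<subseteq> X" "set ys \<subseteq> Y" "set ms \<subseteq> gapp (set xs) (set ys)" by auto
  from Cons.prems obtain zs where 2: "set zs \<subseteq> Y" "Arrow zs m \<in> X" by (auto simp: gapp_def)
  have "m \<in> gapp (set (Arrow zs m # xs)) (set (zs @ ys))" unfolding gapp_def by auto
  moreover have "gapp (set xs) (set ys) \<subseteq> gapp (set (Arrow zs m # xs)) (set (zs @ ys))"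
    by (rule gapp_mono) auto
  ultimately have "set (m # ms) \<subseteq> gapp (set (Arrow zs m # xs)) (set (zs @ ys))"
    using 1 by auto
  with 1 2 show ?case
    by (intro exI[of _ "Arrow zs m # xs"] exI[of _ "zs @ ys"]) auto
qed

lemma gS: "gapp (gapp (gapp gS X) Y) Z = gapp (gapp X Z) (gapp Y Z)"
proof (intro set_eqI iffI)
  fix m assume "m \<in> gapp (gapp (gapp gS X) Y) Z"
  then obtain xs ys zs where *: "set xs \<subseteq> X" "set ys \<subseteq> Y" "set zs \<subseteq> Z"
    "m \<in> gapp (gapp (set xs) (set zs)) (gapp (set ys) (set zs))"
    by (elim gappE) (auto simp: gS_def)
  have "gapp (gapp (set xs) (set zs)) (gapp (set ys) (set zs)) \<subseteq> gapp (gapp X Z) (gapp Y Z)"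
    by (intro gapp_mono * )
  with * show "m \<in> gapp (gapp X Z) (gapp Y Z)" by blast
next
  fix m assume "m \<in> gapp (gapp X Z) (gapp Y Z)"
  then have "set [m] \<subseteq> gapp (gapp X Z) (gapp Y Z)" by simp
  from gapp_finite[OF this] obtain us vs where 1: "set us \<subseteq> gapp X Z" "set vs \<subseteq> gapp Y Z"
    "m \<in> gapp (set us) (set vs)" by auto
  from gapp_finite[OF 1(1)] obtain xs zs where 2: "set xs \<subseteq> X" "set zs \<subseteq> Z"
    "set us \<subseteq> gapp (set xs) (set zs)" by auto
  from gapp_finite[OF 1(2)] obtain ys zs' where 3: "set ys \<subseteq> Y" "set zs' \<subseteq> Z"
    "set vs \<subseteq> gapp (set ys) (set zs')" by auto
  let ?z = "zs @ zs'"
  have "gapp (set us) (set vs) \<subseteq> gapp (gapp (set xs) (set ?z)) (gapp (set ys) (set ?z))"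
    by (intro gapp_mono order.trans[OF 2(3)] order.trans[OF 3(3)]) auto
  with 1(3) have "Arrow xs (Arrow ys (Arrow ?z m)) \<in> gS" unfolding gS_def by blast
  moreover have "set ?z \<subseteq> Z" using 2 3 by simp
  ultimately show "m \<in> gapp (gapp (gapp gS X) Y) Z" using 2(1) 3(1) by (meson gappI)
qed

primrec geval :: "cl \<Rightarrow> graph set" where
  "geval CK = gK"
| "geval CS = gS"
| "geval (CApp t u) = gapp (geval t) (geval u)"

lemma geval_cl_eq: "cl_eq t u \<Longrightarrow> geval t = geval u"
  by (induction rule: cl_eq.induct) (simp_all add: gK gS)

lemma cK_neq_cS: "cK \<noteq> cS"
proof transfer
  \<comment> \<open>Tokens of \<open>gS\<close> begin with three nested arrows, while
    \<open>gK\<close> has tokens with just two.\<close>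
  have "Arrow [Atom] (Arrow [] Atom) \<in> gK" "Arrow [Atom] (Arrow [] Atom) \<notin> gS"
    by (auto simp: gK_def gS_def)
  then show "\<not> cl_eq CK CS" using geval_cl_eq[of CK CS] by auto
qed

text \<open>Scott numerals: a numeral is its own case distinction.\<close>

definition "cSuc = cB \<cdot> cK \<cdot> (cC \<cdot> cI)"

lemma cSuc [simp]: "cSuc \<cdot> n \<cdot> x \<cdot> y = y \<cdot> n"
  by (simp add: cSuc_def)

primrec num :: "nat \<Rightarrow> comb" where
  "num 0 = cK"
| "num (Suc n) = cSuc \<cdot> num n"

text \<open>Case distinction separates the numerals: with branches \<open>cK\<close> and the
  constant function \<open>cK \<cdot> cS\<close>, 0 yields \<open>cK\<close> and 1 yields
  \<open>cS\<close>.\<close>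

lemma num_0_neq_num_1: "num 0 \<noteq> num 1"
proof
  assume "num 0 = num 1"
  then have "num 0 \<cdot> cK \<cdot> (cK \<cdot> cS) = num 1 \<cdot> cK \<cdot> (cK \<cdot> cS)" by simp
  with cK_neq_cS show False by simp
qed

text \<open>Since arities are implicit in \<open>computes\<close>, an argument tuple of any length
  is packed into a single combinator.\<close>

primrec enc :: "nat list \<Rightarrow> comb" where
  "enc [] = cK"
| "enc (n # ns) = cPair \<cdot> num n \<cdot> enc ns"

inductive_cases computes_elims: "computes RZero xs y" "computes RSuc xs y" "computes (RProj i) xs y"
  "computes (RComp f gs) xs y" "computes (RMu f) xs y"

text \<open>Only halting runs are constrained, so primitive recursion and search may both be defined
  by unrestricted fixed points and verified along a given run.\<close>

lemma representable: "\<exists>p. \<forall>xs y. computes r xs y \<longrightarrow> p \<cdot> enc xs = num y"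
proof (induction r)
  case RZero
  show ?case by (rule exI[of _ "cK \<cdot> cK"]) (auto elim!: computes_elims)
next
  case RSuc
  show ?case by (rule exI[of _ "cB \<cdot> cSuc \<cdot> cFst"]) (auto elim!: computes_elims)
next
  case (RProj i)
  \<comment> \<open>The argument with index \<open>i\<close> is the head after \<open>i\<close>
    tails; the iterated tail is itself a combinator.\<close>
  have "i < length xs \<Longrightarrow> (cFst \<cdot> ((\<lambda>l. cSnd \<cdot> l) ^^ i) (enc xs)) = num (xs ! i)" for xs
  proof (induction i arbitrary: xs)
    case 0
    then show ?case by (cases xs) auto
  next
    case (Suc i)
    then show ?case by (cases xs) (auto simp: funpow_swap1)
  qed
  moreover have "\<exists>p. \<forall>l. p \<cdot> l = ((\<lambda>l. cSnd \<cdot> l) ^^ i) l"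
  proof (induction i)
    case 0
    show ?case by (rule exI[of _ cI]) simp
  next
    case (Suc i)
    then obtain p where "\<forall>l. p \<cdot> l = ((\<lambda>l. cSnd \<cdot> l) ^^ i) l" ..
    then show ?case by (intro exI[of _ "cB \<cdot> cSnd \<cdot> p"]) simp
  qed
  then obtain p where "\<forall>l. p \<cdot> l = ((\<lambda>l. cSnd \<cdot> l) ^^ i) l" ..
  ultimately show ?case by (intro exI[of _ "cB \<cdot> cFst \<cdot> p"]) (auto elim!: computes_elims)
next
  case (RComp f gs)
  from RComp.IH(1) obtain F where F: "\<And>xs y. computes f xs y \<Longrightarrow> F \<cdot> enc xs = num y" by blast
  have "\<exists>G. \<forall>xs ys. list_all2 (\<lambda>g y. computes g xs y) gs ys \<longrightarrow> G \<cdot> enc xs = enc ys"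
    using RComp.IH(2)
  proof (induction gs)
    case Nil
    show ?case by (rule exI[of _ "cK \<cdot> cK"]) auto
  next
    case (Cons g gs)
    then obtain G where "\<And>xs ys. list_all2 (\<lambda>g y. computes g xs y) gs ys \<Longrightarrow> G \<cdot> enc xs = enc ys"
      by (metis list.set_intros(2))
    moreover from Cons.prems obtain H where "\<And>xs y. computes g xs y \<Longrightarrow> H \<cdot> enc xs = num y"
      by (metis list.set_intros(1))
    ultimately show ?case
      by (intro exI[of _ "cSpair H G"]) (auto simp: list_all2_Cons1)
  qed
  then obtain G where G: "\<And>xs ys. list_all2 (\<lambda>g y. computes g xs y) gs ys \<Longrightarrow> G \<cdot> enc xs = enc ys"
    by blast
  show ?case
    by (rule exI[of _ "cB \<cdot> F \<cdot> G"]) (auto elim!: computes_elims simp: F G)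
next
  case (RPrim f g)
  then obtain F G where F: "\<And>xs y. computes f xs y \<Longrightarrow> F \<cdot> enc xs = num y"
    and G: "\<And>xs y. computes g xs y \<Longrightarrow> G \<cdot> enc xs = num y" by metis
  \<comment> \<open>\<open>R (n, l) = n (F l) (\<lambda>m. G (m, R (m, l), l))\<close>; the body \<open>h\<close> of the inner abstraction acts on the
    environment \<open>((R, (n, l)), m)\<close>.\<close>
  define h where "h = cB \<cdot> G \<cdot> cSpair cSnd (cSpair (cS \<cdot> (cB \<cdot> cFst \<cdot> cFst) \<cdot>
    cSpair cSnd (cB \<cdot> cSnd \<cdot> (cB \<cdot> cSnd \<cdot> cFst))) (cB \<cdot> cSnd \<cdot> (cB \<cdot> cSnd \<cdot> cFst)))"
  define \<phi> where "\<phi> = cS \<cdot> (cS \<cdot> (cB \<cdot> cFst \<cdot> cSnd) \<cdot> (cB \<cdot> F \<cdot> (cB \<cdot> cSnd \<cdot> cSnd))) \<cdot> (cCurry \<cdot> h)"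
  obtain R where R: "R = cCurry \<cdot> \<phi> \<cdot> R" using fixpoint by blast
  have step: "R \<cdot> (cPair \<cdot> n \<cdot> l) = n \<cdot> (F \<cdot> l) \<cdot> (cCurry \<cdot> h \<cdot> (cPair \<cdot> R \<cdot> (cPair \<cdot> n \<cdot> l)))" for n l
    by (subst R) (simp add: \<phi>_def)
  have "R \<cdot> enc zs = num y" if "computes (RPrim f g) zs y" for zs y
    using that
  proof (induction "RPrim f g" zs y rule: computes.induct)
    case (prim_0 xs y)
    then show ?case by (simp add: step F)
  next
    case (prim_Suc n xs y z)
    then show ?case using G[of "n # y # xs" z] by (simp add: step h_def)
  qed
  then show ?case by blast
next
  case (RMu f)
  then obtain F where F: "\<And>xs y. computes f xs y \<Longrightarrow> F \<cdot> enc xs = num y" by blast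
  \<comment> \<open>\<open>M (n, l) = F (n, l) n (\<lambda>_. M (n + 1, l))\<close>, where \<open>\<phi>\<close> acts on the environment \<open>(M, (n, l))\<close>.\<close>
  define \<phi> where "\<phi> = cS \<cdot> (cS \<cdot> (cB \<cdot> F \<cdot> cSnd) \<cdot> (cB \<cdot> cFst \<cdot> cSnd)) \<cdot> (cB \<cdot> cK \<cdot>
    (cS \<cdot> cFst \<cdot> cSpair (cB \<cdot> cSuc \<cdot> (cB \<cdot> cFst \<cdot> cSnd)) (cB \<cdot> cSnd \<cdot> cSnd)))"
  obtain M where M: "M = cCurry \<cdot> \<phi> \<cdot> M" using fixpoint by blast
  have step: "M \<cdot> (cPair \<cdot> n \<cdot> l) = F \<cdot> (cPair \<cdot> n \<cdot> l) \<cdot> n \<cdot> (cK \<cdot> (M \<cdot> (cPair \<cdot> (cSuc \<cdot> n) \<cdot> l)))" for n l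
    by (subst M) (simp add: \<phi>_def)
  \<comment> \<open>The search is followed backwards from the least zero \<open>n\<close>, where the
    value of \<open>F\<close> is \<open>cK\<close> and selects \<open>n\<close>; \<open>k\<close> is
    the distance below it. A positive value of \<open>F\<close> selects the constant function whose
    value is the next stage.\<close>
  have "M \<cdot> (cPair \<cdot> num (n - k) \<cdot> enc xs) = num n"
    if n: "computes f (n # xs) 0" "\<forall>m<n. \<exists>y. computes f (m # xs) (Suc y)" and "k \<le> n" for n k xs
    using that(3)
  proof (induction k)
    case 0
    then show ?case using F[OF n(1)] by (subst step) simp
  next
    case (Suc k)
    then obtain y where "computes f ((n - Suc k) # xs) (Suc y)" using n(2)
      by (metis Suc_le_lessD diff_less less_le_trans zero_less_Suc)
    moreover have "num (n - k) = cSuc \<cdot> num (n - Suc k)"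
      using Suc.prems by (metis Suc_diff_Suc Suc_le_lessD num.simps(2))
    ultimately show ?case using Suc F[of "(n - Suc k) # xs"] by (subst step) simp
  qed
  \<comment> \<open>Taking \<open>k = n\<close> starts the search at 0.\<close>
  from this[of _ _ "n" for n] have "M \<cdot> (cPair \<cdot> num 0 \<cdot> enc xs) = num n"
    if "computes f (n # xs) 0" "\<forall>m<n. \<exists>y. computes f (m # xs) (Suc y)" for n xs
    using that by (metis diff_self_eq_0 order_refl)
  then show ?case
    by (intro exI[of _ "cB \<cdot> M \<cdot> (cPair \<cdot> num 0)"]) (auto elim!: computes_elims)
qed

section \<open>A model in partial equivalence relations\<close>

text \<open>
  Raw terms and substitutions denote combinators acting on environments, and environments are nested
  pairs. Annotations are ignored by terms, so the interpretation is total on raw syntax.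
\<close>

type_synonym rel = "comb \<Rightarrow> comb \<Rightarrow> bool"

definition per :: "rel \<Rightarrow> bool" where
  "per R \<longleftrightarrow> (\<forall>x y. R x y \<longrightarrow> R y x) \<and> (\<forall>x y z. R x y \<longrightarrow> R y z \<longrightarrow> R x z)"

text \<open>Total relations at \<open>Empty\<close> and \<open>TUnit\<close> make any two arrows or
  elements there agree. An identity type relates everything or nothing, so its elements carry no
  information and \<open>cI\<close> serves as a dummy value. Functions are compared by their action
  on related arguments, which gives eta for \<open>TPi\<close> without extensionality.\<close>

primrec ctx_rel :: "ctx \<Rightarrow> rel" and sub_val :: "sub \<Rightarrow> comb"
  and ty_rel :: "ty \<Rightarrow> comb \<Rightarrow> rel" and tm_val :: "tm \<Rightarrow> comb" where
  "ctx_rel Empty = (\<lambda>_ _. True)"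
| "ctx_rel (\<Gamma> \<triangleright> A) = (\<lambda>\<rho> \<sigma>. ctx_rel \<Gamma> (cFst \<cdot> \<rho>) (cFst \<cdot> \<sigma>) \<and> ty_rel A (cFst \<cdot> \<rho>) (cSnd \<cdot> \<rho>) (cSnd \<cdot> \<sigma>))"
| "sub_val (\<gamma> \<odot> \<delta>) = cB \<cdot> sub_val \<gamma> \<cdot> sub_val \<delta>"
| "sub_val id\<^bsub>\<Gamma>\<^esub> = cI"
| "sub_val \<langle>\<rangle>\<^bsub>\<Gamma>\<^esub> = cI"
| "sub_val p\<^bsub>A\<^esub> = cFst"
| "sub_val \<langle>\<gamma>, a\<rangle>\<^bsub>A\<^esub> = cSpair (sub_val \<gamma>) (tm_val a)"
| "ty_rel TBase = (\<lambda>_. (=))"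
| "ty_rel (A[\<gamma>]\<^sub>T) = (\<lambda>\<rho>. ty_rel A (sub_val \<gamma> \<cdot> \<rho>))"
| "ty_rel (TId A a b) = (\<lambda>\<rho> _ _. ty_rel A \<rho> (tm_val a \<cdot> \<rho>) (tm_val b \<cdot> \<rho>))"
| "ty_rel TUnit = (\<lambda>_ _ _. True)"
| "ty_rel (TSigma A B) = (\<lambda>\<rho> x y. ty_rel A \<rho> (cFst \<cdot> x) (cFst \<cdot> y) \<and>
    ty_rel B (cPair \<cdot> \<rho> \<cdot> (cFst \<cdot> x)) (cSnd \<cdot> x) (cSnd \<cdot> y))"
| "ty_rel (TPi A B) = (\<lambda>\<rho> f g. \<forall>x y. ty_rel A \<rho> x y \<longrightarrow>
    ty_rel B (cPair \<cdot> \<rho> \<cdot> x) (f \<cdot> x) (g \<cdot> y))"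
| "tm_val (a[\<gamma>]\<^sub>t) = cB \<cdot> tm_val a \<cdot> sub_val \<gamma>"
| "tm_val q\<^bsub>A\<^esub> = cSnd"
| "tm_val (Refl a) = cI"
| "tm_val Star = cI"
| "tm_val (Fst A c) = cB \<cdot> cFst \<cdot> tm_val c"
| "tm_val (Snd A B c) = cB \<cdot> cSnd \<cdot> tm_val c"
| "tm_val (MkPair A B a b) = cSpair (tm_val a) (tm_val b)"
| "tm_val (App A B c a) = cS \<cdot> tm_val c \<cdot> tm_val a"
| "tm_val (Lam A b) = cCurry \<cdot> tm_val b"

section \<open>Validity over a relation on environments\<close>

definition val_ty :: "rel \<Rightarrow> (comb \<Rightarrow> rel) \<Rightarrow> (comb \<Rightarrow> rel) \<Rightarrow> bool" where
  "val_ty P X Y \<longleftrightarrow> (\<forall>\<rho> \<sigma>. P \<rho> \<sigma> \<longrightarrow> X \<rho> = Y \<sigma> \<and> per (X \<rho>))"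

definition val_tm :: "rel \<Rightarrow> comb \<Rightarrow> comb \<Rightarrow> (comb \<Rightarrow> rel) \<Rightarrow> bool" where
  "val_tm P a b X \<longleftrightarrow> (\<forall>\<rho> \<sigma>. P \<rho> \<sigma> \<longrightarrow> X \<rho> (a \<cdot> \<rho>) (b \<cdot> \<sigma>))"

definition val_sub :: "rel \<Rightarrow> comb \<Rightarrow> comb \<Rightarrow> rel \<Rightarrow> bool" where
  "val_sub Q g h P \<longleftrightarrow> (\<forall>\<rho> \<sigma>. Q \<rho> \<sigma> \<longrightarrow> P (g \<cdot> \<rho>) (h \<cdot> \<sigma>))"

text \<open>
  The type of \<open>c\<close> in the reflection rule does not record that the type \<open>A\<close> inside \<^term>\<open>TId A a a'\<close>
  is valid; soundness of that rule needs this invariant.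
\<close>

primrec hered_valid :: "rel \<Rightarrow> ty \<Rightarrow> bool" where
  "hered_valid P TBase = True"
| "hered_valid P (A[\<gamma>]\<^sub>T) = True"
| "hered_valid P (TId A a b) \<longleftrightarrow> val_ty P (ty_rel A) (ty_rel A) \<and> hered_valid P A \<and>
     val_tm P (tm_val a) (tm_val a) (ty_rel A) \<and> val_tm P (tm_val b) (tm_val b) (ty_rel A)"
| "hered_valid P TUnit = True"
| "hered_valid P (TSigma A B) = True"
| "hered_valid P (TPi A B) = True"

definition sem_ctx :: "ctx \<Rightarrow> ctx \<Rightarrow> bool" where
  "sem_ctx \<Gamma> \<Gamma>' \<longleftrightarrow> ctx_rel \<Gamma> = ctx_rel \<Gamma>' \<and> per (ctx_rel \<Gamma>)"

definition sem_sub :: "ctx \<Rightarrow> sub \<Rightarrow> sub \<Rightarrow> ctx \<Rightarrow> bool" where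
  "sem_sub \<Delta> \<gamma> \<gamma>' \<Gamma> \<longleftrightarrow> per (ctx_rel \<Delta>) \<and> per (ctx_rel \<Gamma>) \<and>
    val_sub (ctx_rel \<Delta>) (sub_val \<gamma>) (sub_val \<gamma>') (ctx_rel \<Gamma>)"

text \<open>Both sides carry \<open>hered_valid\<close>: \<open>tm_pres\<close> then transfers it to
  the new type of a term. In particular a substituted identity type acquires it through
  \<open>I_subst\<close>, before \<open>reflection\<close> can apply to it.\<close>

definition sem_ty :: "ctx \<Rightarrow> ty \<Rightarrow> ty \<Rightarrow> bool" where
  "sem_ty \<Gamma> A A' \<longleftrightarrow> per (ctx_rel \<Gamma>) \<and> val_ty (ctx_rel \<Gamma>) (ty_rel A) (ty_rel A') \<and>
    hered_valid (ctx_rel \<Gamma>) A \<and> hered_valid (ctx_rel \<Gamma>) A'"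

text \<open>Rules such as \<open>tm_sym\<close> have no premise about the context or the type, so
  the validity of both must travel inside the judgment for the induction to go through.\<close>

definition sem_tm :: "ctx \<Rightarrow> tm \<Rightarrow> tm \<Rightarrow> ty \<Rightarrow> bool" where
  "sem_tm \<Gamma> a a' A \<longleftrightarrow> per (ctx_rel \<Gamma>) \<and> val_ty (ctx_rel \<Gamma>) (ty_rel A) (ty_rel A) \<and>
    hered_valid (ctx_rel \<Gamma>) A \<and> val_tm (ctx_rel \<Gamma>) (tm_val a) (tm_val a') (ty_rel A)"

lemma per_sym: "per R \<Longrightarrow> R x y \<Longrightarrow> R y x" unfolding per_def by blast
lemma per_trans: "per R \<Longrightarrow> R x y \<Longrightarrow> R y z \<Longrightarrow> R x z" unfolding per_def by blast
lemma per_refl1: "per R \<Longrightarrow> R x y \<Longrightarrow> R x x" unfolding per_def by blast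
lemma per_refl2: "per R \<Longrightarrow> R x y \<Longrightarrow> R y y" unfolding per_def by blast

lemma val_tyD1: "val_ty P X Y \<Longrightarrow> P \<rho> \<sigma> \<Longrightarrow> X \<rho> = Y \<sigma>"
  and val_tyD2: "val_ty P X Y \<Longrightarrow> P \<rho> \<sigma> \<Longrightarrow> per (X \<rho>)"
  unfolding val_ty_def by blast+

lemma val_ty_left: "per P \<Longrightarrow> val_ty P X Y \<Longrightarrow> val_ty P X X"
  unfolding val_ty_def by (metis per_refl2)

lemma val_ty_sym: "per P \<Longrightarrow> val_ty P X Y \<Longrightarrow> val_ty P Y X"
  unfolding val_ty_def by (metis per_sym)

lemma val_ty_trans: "per P \<Longrightarrow> val_ty P X Y \<Longrightarrow> val_ty P Y Z \<Longrightarrow> val_ty P X Z"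
  unfolding val_ty_def by (metis per_refl2)

lemma val_ty_right: "per P \<Longrightarrow> val_ty P X Y \<Longrightarrow> val_ty P Y Y"
  using val_ty_left val_ty_sym by blast

lemma val_tm_sym: "per P \<Longrightarrow> val_ty P X X \<Longrightarrow> val_tm P a b X \<Longrightarrow> val_tm P b a X"
  unfolding val_tm_def val_ty_def by (metis per_sym)

lemma val_tm_trans: "per P \<Longrightarrow> val_ty P X X \<Longrightarrow> val_tm P a b X \<Longrightarrow> val_tm P b c X \<Longrightarrow> val_tm P a c X"
  unfolding val_tm_def val_ty_def by (metis per_trans per_refl2)

lemma val_tm_left: "per P \<Longrightarrow> val_ty P X X \<Longrightarrow> val_tm P a b X \<Longrightarrow> val_tm P a a X"
  using val_tm_sym val_tm_trans by blast

lemma val_tm_conv: "val_ty P X Y \<Longrightarrow> per P \<Longrightarrow> val_tm P a b X \<Longrightarrow> val_tm P a b Y"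
  unfolding val_tm_def val_ty_def by (metis per_refl1)

definition ext :: "rel \<Rightarrow> (comb \<Rightarrow> rel) \<Rightarrow> rel" where
  "ext P X = (\<lambda>\<rho> \<sigma>. P (cFst \<cdot> \<rho>) (cFst \<cdot> \<sigma>) \<and> X (cFst \<cdot> \<rho>) (cSnd \<cdot> \<rho>) (cSnd \<cdot> \<sigma>))"

lemma ctx_rel_Extend: "ctx_rel (\<Gamma> \<triangleright> A) = ext (ctx_rel \<Gamma>) (ty_rel A)"
  by (simp add: ext_def)

lemma ext_pair: "ext P X (cPair \<cdot> \<rho> \<cdot> x) (cPair \<cdot> \<sigma> \<cdot> y) \<longleftrightarrow> P \<rho> \<sigma> \<and> X \<rho> x y"
  by (simp add: ext_def)

lemma per_ext: "per P \<Longrightarrow> val_ty P X X \<Longrightarrow> per (ext P X)"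
  unfolding per_def[of "ext P X"]
proof (intro conjI allI impI)
  fix \<rho> \<sigma>
  assume P: "per P" and X: "val_ty P X X" and "ext P X \<rho> \<sigma>"
  then have 1: "P (cFst \<cdot> \<rho>) (cFst \<cdot> \<sigma>)" "X (cFst \<cdot> \<rho>) (cSnd \<cdot> \<rho>) (cSnd \<cdot> \<sigma>)"
    by (auto simp: ext_def)
  note 2 = val_tyD1[OF X 1(1)] val_tyD2[OF X 1(1)]
  show "ext P X \<sigma> \<rho>" using per_sym[OF P 1(1)] per_sym[OF 2(2) 1(2)] 2(1) by (simp add: ext_def)
  fix \<tau> assume "ext P X \<sigma> \<tau>"
  then have 3: "P (cFst \<cdot> \<sigma>) (cFst \<cdot> \<tau>)" "X (cFst \<cdot> \<sigma>) (cSnd \<cdot> \<sigma>) (cSnd \<cdot> \<tau>)"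
    by (auto simp: ext_def)
  show "ext P X \<rho> \<tau>" using per_trans[OF P 1(1) 3(1)] per_trans[OF 2(2) 1(2)] 3(2) 2(1)
    by (simp add: ext_def)
qed

lemma ext_cong: "per P \<Longrightarrow> val_ty P X Y \<Longrightarrow> ext P X = ext P Y"
  unfolding ext_def fun_eq_iff by (metis per_refl1 val_tyD1)

lemma val_ty_Sigma:
  assumes "per P" "val_ty P X X'" "val_ty (ext P X) Y Y'"
  shows "val_ty P (\<lambda>\<rho> x y. X \<rho> (cFst \<cdot> x) (cFst \<cdot> y) \<and> Y (cPair \<cdot> \<rho> \<cdot> (cFst \<cdot> x)) (cSnd \<cdot> x) (cSnd \<cdot> y))
     (\<lambda>\<rho> x y. X' \<rho> (cFst \<cdot> x) (cFst \<cdot> y) \<and> Y' (cPair \<cdot> \<rho> \<cdot> (cFst \<cdot> x)) (cSnd \<cdot> x) (cSnd \<cdot> y))"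
  unfolding val_ty_def
proof (intro allI impI conjI)
  fix \<rho> \<sigma> assume P: "P \<rho> \<sigma>"
  have X: "X \<rho> = X' \<sigma>" "per (X \<rho>)" using assms(2) P by (auto dest: val_tyD1 val_tyD2)
  have Y: "Y (cPair \<cdot> \<rho> \<cdot> x) = Y' (cPair \<cdot> \<sigma> \<cdot> y)" "per (Y (cPair \<cdot> \<rho> \<cdot> x))" if "X \<rho> x y" for x y
    using val_tyD1[OF assms(3)] val_tyD2[OF assms(3)] that P by (metis ext_pair)+
  \<comment> \<open>Both \<open>(\<rho>, x)\<close> and \<open>(\<rho>, y)\<close> are related to
    \<open>(\<sigma>, y)\<close>, so the fibres over related points coincide; this lets symmetry and
    transitivity move second components between fibres.\<close>
  have Y2: "Y (cPair \<cdot> \<rho> \<cdot> x) = Y (cPair \<cdot> \<rho> \<cdot> y)" if "X \<rho> x y" for x y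
    using Y that X(2) by (metis per_sym per_refl2)
  show "(\<lambda>x y. X \<rho> (cFst \<cdot> x) (cFst \<cdot> y) \<and> Y (cPair \<cdot> \<rho> \<cdot> (cFst \<cdot> x)) (cSnd \<cdot> x) (cSnd \<cdot> y)) =
    (\<lambda>x y. X' \<sigma> (cFst \<cdot> x) (cFst \<cdot> y) \<and> Y' (cPair \<cdot> \<sigma> \<cdot> (cFst \<cdot> x)) (cSnd \<cdot> x) (cSnd \<cdot> y))"
    unfolding fun_eq_iff using X Y per_refl1 by metis
  show "per (\<lambda>x y. X \<rho> (cFst \<cdot> x) (cFst \<cdot> y) \<and> Y (cPair \<cdot> \<rho> \<cdot> (cFst \<cdot> x)) (cSnd \<cdot> x) (cSnd \<cdot> y))"
    unfolding per_def[of "\<lambda>x y. _ x y \<and> _ x y"] using X(2) Y(2) Y2 per_sym per_trans by metis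
qed

lemma val_ty_Pi:
  assumes "per P" "val_ty P X X'" "val_ty (ext P X) Y Y'"
  shows "val_ty P (\<lambda>\<rho> f g. \<forall>x y. X \<rho> x y \<longrightarrow> Y (cPair \<cdot> \<rho> \<cdot> x) (f \<cdot> x) (g \<cdot> y))
     (\<lambda>\<rho> f g. \<forall>x y. X' \<rho> x y \<longrightarrow> Y' (cPair \<cdot> \<rho> \<cdot> x) (f \<cdot> x) (g \<cdot> y))"
  unfolding val_ty_def
proof (intro allI impI conjI)
  fix \<rho> \<sigma> assume P: "P \<rho> \<sigma>"
  have X: "X \<rho> = X' \<sigma>" "per (X \<rho>)" using assms(2) P by (auto dest: val_tyD1 val_tyD2)
  have Y: "Y (cPair \<cdot> \<rho> \<cdot> x) = Y' (cPair \<cdot> \<sigma> \<cdot> y)" "per (Y (cPair \<cdot> \<rho> \<cdot> x))" if "X \<rho> x y" for x y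
    using val_tyD1[OF assms(3)] val_tyD2[OF assms(3)] that P by (metis ext_pair)+
  have Y2: "Y (cPair \<cdot> \<rho> \<cdot> x) = Y (cPair \<cdot> \<rho> \<cdot> y)" if "X \<rho> x y" for x y
    using Y that X(2) by (metis per_sym per_refl2)
  show "(\<lambda>f g. \<forall>x y. X \<rho> x y \<longrightarrow> Y (cPair \<cdot> \<rho> \<cdot> x) (f \<cdot> x) (g \<cdot> y)) =
    (\<lambda>f g. \<forall>x y. X' \<sigma> x y \<longrightarrow> Y' (cPair \<cdot> \<sigma> \<cdot> x) (f \<cdot> x) (g \<cdot> y))"
    unfolding fun_eq_iff using X Y per_refl1 by metis
  show "per (\<lambda>f g. \<forall>x y. X \<rho> x y \<longrightarrow> Y (cPair \<cdot> \<rho> \<cdot> x) (f \<cdot> x) (g \<cdot> y))"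
    unfolding per_def[of "\<lambda>f g. \<forall>x y. _ f g x y"]
  proof (intro conjI allI impI)
    fix f g x y
    assume "\<forall>x y. X \<rho> x y \<longrightarrow> Y (cPair \<cdot> \<rho> \<cdot> x) (f \<cdot> x) (g \<cdot> y)" "X \<rho> x y"
    then show "Y (cPair \<cdot> \<rho> \<cdot> x) (g \<cdot> x) (f \<cdot> y)"
      using X(2) Y(2) Y2 by (metis per_sym)
  next
    fix f g h x y
    assume "\<forall>x y. X \<rho> x y \<longrightarrow> Y (cPair \<cdot> \<rho> \<cdot> x) (f \<cdot> x) (g \<cdot> y)"
      "\<forall>x y. X \<rho> x y \<longrightarrow> Y (cPair \<cdot> \<rho> \<cdot> x) (g \<cdot> x) (h \<cdot> y)" "X \<rho> x y"
    \<comment> \<open>The middle value is \<open>g \<cdot> x\<close>: the first hypothesis is used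
      at \<open>(x, x)\<close>, the second at \<open>(x, y)\<close>.\<close>
    then show "Y (cPair \<cdot> \<rho> \<cdot> x) (f \<cdot> x) (h \<cdot> y)"
      using X(2) Y(2) per_trans per_refl1 by metis
  qed
qed

lemma val_sub_sym: "per P \<Longrightarrow> per Q \<Longrightarrow> val_sub Q g h P \<Longrightarrow> val_sub Q h g P"
  unfolding val_sub_def by (metis per_sym)

lemma val_sub_trans: "per P \<Longrightarrow> per Q \<Longrightarrow> val_sub Q g h P \<Longrightarrow> val_sub Q h k P \<Longrightarrow> val_sub Q g k P"
  unfolding val_sub_def by (metis per_trans per_refl2)

lemma val_ty_TId:
  assumes "per P" "val_ty P X Y" "val_tm P a a' X" "val_tm P b b' X"
  shows "val_ty P (\<lambda>\<rho> _ _. X \<rho> (a \<cdot> \<rho>) (b \<cdot> \<rho>)) (\<lambda>\<rho> _ _. Y \<rho> (a' \<cdot> \<rho>) (b' \<cdot> \<rho>))"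
  unfolding val_ty_def
proof (intro allI impI conjI)
  fix \<rho> \<sigma> assume P: "P \<rho> \<sigma>"
  have X: "X \<rho> = Y \<sigma>" "per (X \<rho>)" using assms(2) P by (auto dest: val_tyD1 val_tyD2)
  have "X \<rho> (a \<cdot> \<rho>) (a' \<cdot> \<sigma>)" "X \<rho> (b \<cdot> \<rho>) (b' \<cdot> \<sigma>)"
    using assms(3,4) P unfolding val_tm_def by blast+
  then have "X \<rho> (a \<cdot> \<rho>) (b \<cdot> \<rho>) \<longleftrightarrow> Y \<sigma> (a' \<cdot> \<sigma>) (b' \<cdot> \<sigma>)"
    unfolding X(1) by (metis X per_sym per_trans)
  then show "(\<lambda>_ _. X \<rho> (a \<cdot> \<rho>) (b \<cdot> \<rho>)) = (\<lambda>_ _. Y \<sigma> (a' \<cdot> \<sigma>) (b' \<cdot> \<sigma>))" by simp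
  show "per (\<lambda>_ _. X \<rho> (a \<cdot> \<rho>) (b \<cdot> \<rho>))" by (simp add: per_def)
qed

lemma per_True [simp]: "per (\<lambda>_ _. True)" by (simp add: per_def)

lemma per_eq [simp]: "per (=)" by (simp add: per_def)

declare ctx_rel.simps(2) [simp del] ctx_rel_Extend [simp]

lemma extD: "ext P X \<rho> \<sigma> \<Longrightarrow> P (cFst \<cdot> \<rho>) (cFst \<cdot> \<sigma>) \<and> X (cFst \<cdot> \<rho>) (cSnd \<cdot> \<rho>) (cSnd \<cdot> \<sigma>)"
  by (simp add: ext_def)

lemma val_ty_reindex:
  "val_ty P X Y \<Longrightarrow> (\<And>\<rho> \<sigma>. Q \<rho> \<sigma> \<Longrightarrow> P (G \<rho>) (H \<sigma>)) \<Longrightarrow>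
    val_ty Q (\<lambda>\<rho>. X (G \<rho>)) (\<lambda>\<rho>. Y (H \<rho>))"
  unfolding val_ty_def by blast

text \<open>The maps \<open>G\<close> and \<open>H\<close> on environments match what a substituted
  type unfolds to. In this and the next three lemmas families are fixed to the form
  \<open>ty_rel A\<close>, so that unification follows the syntax.\<close>

lemma val_ty_subst':
  "val_ty P (ty_rel A) (ty_rel A') \<Longrightarrow> (\<And>\<rho> \<sigma>. Q \<rho> \<sigma> \<Longrightarrow> P (G \<rho>) (H \<sigma>)) \<Longrightarrow>
    val_ty Q (\<lambda>\<rho>. ty_rel A (G \<rho>)) (\<lambda>\<rho>. ty_rel A' (H \<rho>))"
  by (rule val_ty_reindex)

lemma val_ty_Sigma':
  "per P \<Longrightarrow> val_ty P (ty_rel A) (ty_rel A') \<Longrightarrow> val_ty (ext P (ty_rel A)) (ty_rel B) (ty_rel B') \<Longrightarrow>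
    (\<And>\<rho> \<sigma>. Q \<rho> \<sigma> \<Longrightarrow> P (G \<rho>) (H \<sigma>)) \<Longrightarrow>
    val_ty Q (\<lambda>\<rho> x y. ty_rel A (G \<rho>) (cFst \<cdot> x) (cFst \<cdot> y) \<and> ty_rel B (cPair \<cdot> G \<rho> \<cdot> (cFst \<cdot> x)) (cSnd \<cdot> x) (cSnd \<cdot> y))
     (\<lambda>\<rho> x y. ty_rel A' (H \<rho>) (cFst \<cdot> x) (cFst \<cdot> y) \<and> ty_rel B' (cPair \<cdot> H \<rho> \<cdot> (cFst \<cdot> x)) (cSnd \<cdot> x) (cSnd \<cdot> y))"
  by (rule val_ty_reindex[OF val_ty_Sigma])

lemma val_ty_Pi':
  "per P \<Longrightarrow> val_ty P (ty_rel A) (ty_rel A') \<Longrightarrow> val_ty (ext P (ty_rel A)) (ty_rel B) (ty_rel B') \<Longrightarrow>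
    (\<And>\<rho> \<sigma>. Q \<rho> \<sigma> \<Longrightarrow> P (G \<rho>) (H \<sigma>)) \<Longrightarrow>
    val_ty Q (\<lambda>\<rho> f g. \<forall>x y. ty_rel A (G \<rho>) x y \<longrightarrow> ty_rel B (cPair \<cdot> G \<rho> \<cdot> x) (f \<cdot> x) (g \<cdot> y))
     (\<lambda>\<rho> f g. \<forall>x y. ty_rel A' (H \<rho>) x y \<longrightarrow> ty_rel B' (cPair \<cdot> H \<rho> \<cdot> x) (f \<cdot> x) (g \<cdot> y))"
  by (rule val_ty_reindex[OF val_ty_Pi])

lemma val_ty_TId':
  "per P \<Longrightarrow> val_ty P (ty_rel A) (ty_rel A') \<Longrightarrow> val_tm P a a' (ty_rel A) \<Longrightarrow> val_tm P b b' (ty_rel A) \<Longrightarrow>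
    (\<And>\<rho> \<sigma>. Q \<rho> \<sigma> \<Longrightarrow> P (G \<rho>) (H \<sigma>)) \<Longrightarrow>
   val_ty Q (\<lambda>\<rho> _ _. ty_rel A (G \<rho>) (a \<cdot> G \<rho>) (b \<cdot> G \<rho>)) (\<lambda>\<rho> _ _. ty_rel A' (H \<rho>) (a' \<cdot> H \<rho>) (b' \<cdot> H \<rho>))"
  by (rule val_ty_reindex[OF val_ty_TId])

lemmas val_ty_intros = per_ext val_ty_left val_ty_right val_ty_subst' val_ty_Sigma' val_ty_Pi' val_ty_TId'[unfolded val_tm_def]

text \<open>This replaces surjective pairing: \<open>ext\<close> sees an environment only through
  its projections, so pairing them again changes nothing. The rule \<open>spair_eta\<close> rests on
  it.\<close>

lemma ext_pair_right [simp]: "ext P X \<rho> (cPair \<cdot> (cFst \<cdot> \<sigma>) \<cdot> (cSnd \<cdot> \<sigma>)) = ext P X \<rho> \<sigma>"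
  by (simp add: ext_def)

lemma ext_pairI: "P \<rho> \<sigma> \<Longrightarrow> X \<rho> x y \<Longrightarrow> ext P X (cPair \<cdot> \<rho> \<cdot> x) (cPair \<cdot> \<sigma> \<cdot> y)"
  by (simp add: ext_pair)

lemma val_ty_subst_left:
  "per Q \<Longrightarrow> val_ty P (ty_rel A) (ty_rel A') \<Longrightarrow> (\<And>\<rho> \<sigma>. Q \<rho> \<sigma> \<Longrightarrow> P (G \<rho>) (H \<sigma>)) \<Longrightarrow>
    val_ty Q (\<lambda>\<rho>. ty_rel A (G \<rho>)) (\<lambda>\<rho>. ty_rel A (G \<rho>))"
  by (rule val_ty_left[OF _ val_ty_subst'])

lemma val_tm_right: "per P \<Longrightarrow> val_ty P X X \<Longrightarrow> val_tm P a b X \<Longrightarrow> val_tm P b b X"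
  using val_tm_sym val_tm_trans by blast

text \<open>The relation of an identity type ignores its elements, so once \<open>a\<close> and
  \<open>b\<close> agree any \<open>c\<close> and \<open>d\<close> are related.\<close>

lemma val_tm_Refl: "per P \<Longrightarrow> val_tm P a b X \<Longrightarrow> val_tm P c d (\<lambda>\<rho> _ _. X \<rho> (a \<cdot> \<rho>) (b \<cdot> \<rho>))"
  unfolding val_tm_def by (blast intro: per_refl1)

text \<open>An inhabitant only shows that \<open>a\<close> and \<open>b\<close> agree at the same
  environment; validity of \<open>b\<close> then carries the relation from \<open>\<rho>\<close> to
  \<open>\<sigma>\<close>.\<close>

lemma val_tm_reflection: "per P \<Longrightarrow> val_ty P X X \<Longrightarrow> val_tm P b b X \<Longrightarrow>
    val_tm P c c (\<lambda>\<rho> _ _. X \<rho> (a \<cdot> \<rho>) (b \<cdot> \<rho>)) \<Longrightarrow> val_tm P a b X"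
  unfolding val_tm_def by (blast intro: per_trans val_tyD2)

text \<open>Validity of the result types of \<open>App\<close> and \<open>Snd\<close>, where the
  last environment entry is the value of a term.\<close>

lemma val_ty_inst:
  "per Q \<Longrightarrow> val_ty (ext Q X) Y Y' \<Longrightarrow> (\<And>\<rho> \<sigma>. Q \<rho> \<sigma> \<Longrightarrow> X \<rho> (a \<cdot> \<rho>) (a' \<cdot> \<sigma>)) \<Longrightarrow>
    val_ty Q (\<lambda>\<rho>. Y (cPair \<cdot> \<rho> \<cdot> (a \<cdot> \<rho>))) (\<lambda>\<rho>. Y (cPair \<cdot> \<rho> \<cdot> (a \<cdot> \<rho>)))"
  by (rule val_ty_left[OF _ val_ty_reindex[where P = "ext Q X"]]) (auto intro: ext_pairI)

lemmas sem_defs = sem_ctx_def sem_sub_def sem_ty_def sem_tm_def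

lemma soundness:
  "\<turnstile>\<^sub>c \<Gamma> \<approx> \<Gamma>' \<Longrightarrow> sem_ctx \<Gamma> \<Gamma>'"
  "\<Delta> \<turnstile>\<^sub>s \<gamma> \<approx> \<gamma>' : \<Gamma>0 \<Longrightarrow> sem_sub \<Delta> \<gamma> \<gamma>' \<Gamma>0"
  "\<Gamma>1 \<turnstile>\<^sub>T A \<approx> A' \<Longrightarrow> sem_ty \<Gamma>1 A A'"
  "\<Gamma>2 \<turnstile>\<^sub>t a \<approx> a' : B \<Longrightarrow> sem_tm \<Gamma>2 a a' B"
proof (induction rule: ctx_eq_sub_eq_ty_eq_tm_eq.inducts)
  case sub_sym
  then show ?case by (auto simp: sem_defs intro: val_sub_sym)
next
  case ty_sym
  then show ?case by (auto simp: sem_defs intro: val_ty_sym)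
next
  case tm_sym
  then show ?case by (auto simp: sem_defs intro: val_tm_sym)
next
  case sub_trans
  then show ?case unfolding sem_defs by (metis val_sub_trans)
next
  case ty_trans
  then show ?case unfolding sem_defs by (metis val_ty_trans)
next
  case tm_trans
  then show ?case unfolding sem_defs by (metis val_tm_trans)
next
  case tm_pres
  then show ?case unfolding sem_defs by (metis val_tm_conv val_ty_right)
next
  case extend_cong
  then show ?case unfolding sem_defs ctx_rel_Extend by (metis ext_cong per_ext val_ty_left)
next
  case base_cong
  then show ?case by (simp add: sem_defs val_ty_def)
next
  case unit_cong
  then show ?case by (simp add: sem_defs val_ty_def)
next
  case (snd_cong \<Gamma> A A' B B' c c')
  then show ?case
    using val_ty_inst[of "ctx_rel \<Gamma>" "ty_rel A" "ty_rel B" "ty_rel B'" "cB \<cdot> cFst \<cdot> tm_val c" "cB \<cdot> cFst \<cdot> tm_val c'"]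
    by (auto simp: sem_defs val_tm_def)
next
  case (app_cong \<Gamma> A A' B B' c c' a a')
  then show ?case
    using val_ty_inst[of "ctx_rel \<Gamma>" "ty_rel A" "ty_rel B" "ty_rel B'" "tm_val a" "tm_val a'"]
    by (auto simp: sem_defs val_tm_def)
next
  case tm_subst_cong
  then show ?case by (auto simp: sem_defs val_tm_def val_sub_def intro: per_ext val_ty_subst_left ext_pairI)
next
  case star_cong
  then show ?case by (simp add: sem_defs val_ty_def val_tm_def)
next
  case reflection
  then show ?case by (auto simp: sem_defs intro: val_tm_reflection)
next
  case I_cong
  then show ?case by (auto simp: sem_defs intro: val_ty_TId val_tm_left val_tm_right val_ty_right val_tm_conv)
next
  case refl_cong
  then show ?case by (auto simp: sem_defs intro: val_ty_TId val_tm_left val_tm_right val_tm_Refl)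
\<comment> \<open>The remaining rules, among them the beta, eta and substitution laws, are
  computations with combinators once the judgments are unfolded.\<close>
qed (auto simp: sem_defs val_tm_def val_sub_def ext_pair dest!: extD intro: val_ty_intros)

section \<open>Combinatory logic inside the calculus\<close>

abbreviation wk :: "ty \<Rightarrow> ctx \<Rightarrow> ty" where
  "wk C \<Gamma> \<equiv> C[\<langle>\<rangle>\<^bsub>\<Gamma>\<^esub>]\<^sub>T"

lemma tm_conv: "\<turnstile>\<^sub>c \<Gamma> \<Longrightarrow> \<Gamma> \<turnstile>\<^sub>t a \<approx> b : A \<Longrightarrow> \<Gamma> \<turnstile>\<^sub>T A \<approx> A' \<Longrightarrow> \<Gamma> \<turnstile>\<^sub>t a \<approx> b : A'"
  by (rule tm_pres)

lemma terminal_ty: "\<turnstile>\<^sub>c \<Gamma> \<Longrightarrow> \<Gamma> \<turnstile>\<^sub>s \<langle>\<rangle>\<^bsub>\<Gamma>\<^esub> : Empty"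
  by (rule terminal_cong)

lemma wk_ty: "\<turnstile>\<^sub>c \<Gamma> \<Longrightarrow> Empty \<turnstile>\<^sub>T C \<Longrightarrow> \<Gamma> \<turnstile>\<^sub>T wk C \<Gamma>"
  by (blast intro: ty_subst_cong terminal_cong)

lemma wk_cong: "\<turnstile>\<^sub>c \<Gamma> \<approx> \<Gamma>' \<Longrightarrow> Empty \<turnstile>\<^sub>T C \<Longrightarrow> \<Gamma> \<turnstile>\<^sub>T wk C \<Gamma> \<approx> wk C \<Gamma>'"
  by (blast intro: ty_subst_cong terminal_cong)

text \<open>A closed type enters a context along the terminal substitution rather than by iterated
  projections. By \<open>terminal_eta\<close> every further substitution is absorbed, so
  \<open>wk C \<Delta>\<close> is a normal form for its instances.\<close>

lemma wk_subst:
  assumes "\<turnstile>\<^sub>c \<Gamma>" "\<Delta> \<turnstile>\<^sub>s \<gamma> : \<Gamma>" "Empty \<turnstile>\<^sub>T C"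
  shows "\<Delta> \<turnstile>\<^sub>T (wk C \<Gamma>)[\<gamma>]\<^sub>T \<approx> wk C \<Delta>"
proof -
  have "\<Delta> \<turnstile>\<^sub>s \<langle>\<rangle>\<^bsub>\<Gamma>\<^esub> \<odot> \<gamma> \<approx> \<langle>\<rangle>\<^bsub>\<Delta>\<^esub> : Empty"
    by (rule terminal_eta) (rule comp_cong assms terminal_ty)+
  then have "\<Delta> \<turnstile>\<^sub>T C[\<langle>\<rangle>\<^bsub>\<Gamma>\<^esub> \<odot> \<gamma>]\<^sub>T \<approx> wk C \<Delta>" using assms(3) by (rule ty_subst_cong[rotated])
  moreover have "\<Delta> \<turnstile>\<^sub>T C[\<langle>\<rangle>\<^bsub>\<Gamma>\<^esub> \<odot> \<gamma>]\<^sub>T \<approx> (wk C \<Gamma>)[\<gamma>]\<^sub>T"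
    by (rule ty_subst_comp) (rule assms terminal_ty)+
  ultimately show ?thesis by (blast intro: ty_sym ty_trans)
qed

lemma extend_ty: "\<turnstile>\<^sub>c \<Gamma> \<Longrightarrow> \<Gamma> \<turnstile>\<^sub>T A \<Longrightarrow> \<turnstile>\<^sub>c \<Gamma> \<triangleright> A"
  by (rule extend_cong)

lemma lift_ty:
  assumes "\<turnstile>\<^sub>c \<Delta>" "\<Delta> \<turnstile>\<^sub>s \<gamma> : \<Gamma>" "\<Gamma> \<turnstile>\<^sub>T A"
  shows "\<Delta> \<triangleright> A[\<gamma>]\<^sub>T \<turnstile>\<^sub>s lift A \<gamma> : \<Gamma> \<triangleright> A"
proof -
  have A: "\<Delta> \<turnstile>\<^sub>T A[\<gamma>]\<^sub>T" by (rule ty_subst_cong assms)+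
  have p: "\<Delta> \<triangleright> A[\<gamma>]\<^sub>T \<turnstile>\<^sub>s p\<^bsub>A[\<gamma>]\<^sub>T\<^esub> : \<Delta>" by (rule p_cong A)+
  have "\<Delta> \<triangleright> A[\<gamma>]\<^sub>T \<turnstile>\<^sub>t q\<^bsub>A[\<gamma>]\<^sub>T\<^esub> : A[\<gamma>]\<^sub>T[p\<^bsub>A[\<gamma>]\<^sub>T\<^esub>]\<^sub>T" by (rule q_cong A)+
  then have "\<Delta> \<triangleright> A[\<gamma>]\<^sub>T \<turnstile>\<^sub>t q\<^bsub>A[\<gamma>]\<^sub>T\<^esub> : A[\<gamma> \<odot> p\<^bsub>A[\<gamma>]\<^sub>T\<^esub>]\<^sub>T"
    by (rule tm_conv[rotated]) (blast intro: assms A p extend_ty ty_sym ty_subst_comp)+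
  then show ?thesis by (blast intro: spair_cong assms comp_cong p)
qed

lemma inst_ty:
  assumes "\<turnstile>\<^sub>c \<Gamma>" "\<Gamma> \<turnstile>\<^sub>T A" "\<Gamma> \<turnstile>\<^sub>t a \<approx> a' : A"
  shows "\<Gamma> \<turnstile>\<^sub>s \<langle>id\<^bsub>\<Gamma>\<^esub>, a\<rangle>\<^bsub>A\<^esub> \<approx> \<langle>id\<^bsub>\<Gamma>\<^esub>, a'\<rangle>\<^bsub>A\<^esub> : \<Gamma> \<triangleright> A"
  by (intro spair_cong assms id_cong tm_conv[OF assms(1,3)] ty_sym[OF ty_subst_id])

abbreviation arr :: "ty \<Rightarrow> ty \<Rightarrow> ty" where
  "arr C D \<equiv> TPi C (wk D (Empty \<triangleright> C))"

lemma arr_ty: "Empty \<turnstile>\<^sub>T C \<Longrightarrow> Empty \<turnstile>\<^sub>T D \<Longrightarrow> Empty \<turnstile>\<^sub>T arr C D"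
  by (intro Pi_cong wk_ty extend_ty empty_cong)

lemma wk_arr:
  assumes "\<turnstile>\<^sub>c \<Gamma>" "Empty \<turnstile>\<^sub>T C" "Empty \<turnstile>\<^sub>T D"
  shows "\<Gamma> \<turnstile>\<^sub>T wk (arr C D) \<Gamma> \<approx> TPi (wk C \<Gamma>) (wk D (\<Gamma> \<triangleright> wk C \<Gamma>))"
proof -
  have C: "\<turnstile>\<^sub>c Empty \<triangleright> C" by (intro extend_ty empty_cong assms)
  have "\<Gamma> \<turnstile>\<^sub>T wk (arr C D) \<Gamma> \<approx> TPi (wk C \<Gamma>) ((wk D (Empty \<triangleright> C))[lift C \<langle>\<rangle>\<^bsub>\<Gamma>\<^esub>]\<^sub>T)"
    by (rule Pi_subst[OF assms(2) wk_ty[OF C assms(3)] terminal_ty[OF assms(1)]])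
  moreover have "\<Gamma> \<turnstile>\<^sub>T TPi (wk C \<Gamma>) ((wk D (Empty \<triangleright> C))[lift C \<langle>\<rangle>\<^bsub>\<Gamma>\<^esub>]\<^sub>T) \<approx>
      TPi (wk C \<Gamma>) (wk D (\<Gamma> \<triangleright> wk C \<Gamma>))"
    by (intro Pi_cong wk_ty assms wk_subst C lift_ty terminal_ty)
  ultimately show ?thesis by (rule ty_trans)
qed

abbreviation fapp :: "ctx \<Rightarrow> ty \<Rightarrow> ty \<Rightarrow> tm \<Rightarrow> tm \<Rightarrow> tm" where
  "fapp \<Gamma> C D c a \<equiv> App (wk C \<Gamma>) (wk D (\<Gamma> \<triangleright> wk C \<Gamma>)) c a"

lemma fapp_cong:
  assumes "\<turnstile>\<^sub>c \<Gamma>" "Empty \<turnstile>\<^sub>T C" "Empty \<turnstile>\<^sub>T D"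
    and "\<Gamma> \<turnstile>\<^sub>t c \<approx> c' : wk (arr C D) \<Gamma>" "\<Gamma> \<turnstile>\<^sub>t a \<approx> a' : wk C \<Gamma>"
  shows "\<Gamma> \<turnstile>\<^sub>t fapp \<Gamma> C D c a \<approx> fapp \<Gamma> C D c' a' : wk D \<Gamma>"
proof (rule tm_conv[OF assms(1)])
  have a: "\<Gamma> \<turnstile>\<^sub>t a : wk C \<Gamma>" using assms(5) by (blast intro: tm_sym tm_trans)
  show "\<Gamma> \<turnstile>\<^sub>t fapp \<Gamma> C D c a \<approx> fapp \<Gamma> C D c' a' :
      (wk D (\<Gamma> \<triangleright> wk C \<Gamma>))[\<langle>id\<^bsub>\<Gamma>\<^esub>, a\<rangle>\<^bsub>wk C \<Gamma>\<^esub>]\<^sub>T"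
    by (rule app_cong) (intro wk_ty extend_ty assms tm_conv[OF assms(1,4)] wk_arr)+
  show "\<Gamma> \<turnstile>\<^sub>T (wk D (\<Gamma> \<triangleright> wk C \<Gamma>))[\<langle>id\<^bsub>\<Gamma>\<^esub>, a\<rangle>\<^bsub>wk C \<Gamma>\<^esub>]\<^sub>T \<approx> wk D \<Gamma>"
    by (intro wk_subst extend_ty wk_ty inst_ty assms a)
qed

text \<open>The rule \<open>app_subst\<close> leaves substituted and lifted annotations. They are
  equal to the weakened ones, \<open>app_cong\<close> exchanges them, and the type of the result
  collapses in the same way.\<close>

lemma fapp_subst:
  assumes "\<turnstile>\<^sub>c \<Gamma>" "\<turnstile>\<^sub>c \<Delta>" "\<Delta> \<turnstile>\<^sub>s \<gamma> : \<Gamma>" "Empty \<turnstile>\<^sub>T C" "Empty \<turnstile>\<^sub>T D"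
    and c: "\<Gamma> \<turnstile>\<^sub>t c : wk (arr C D) \<Gamma>" and a: "\<Gamma> \<turnstile>\<^sub>t a : wk C \<Gamma>"
  shows "\<Delta> \<turnstile>\<^sub>t (fapp \<Gamma> C D c a)[\<gamma>]\<^sub>t \<approx> fapp \<Delta> C D (c[\<gamma>]\<^sub>t) (a[\<gamma>]\<^sub>t) : wk D \<Delta>"
proof -
  let ?C = "wk C \<Gamma>" let ?D = "wk D (\<Gamma> \<triangleright> ?C)"
  have C: "\<Gamma> \<turnstile>\<^sub>T ?C" "\<turnstile>\<^sub>c \<Gamma> \<triangleright> ?C" by (intro wk_ty extend_ty assms)+
  have D: "\<Gamma> \<triangleright> ?C \<turnstile>\<^sub>T ?D" by (intro wk_ty C assms)
  have c': "\<Gamma> \<turnstile>\<^sub>t c : TPi ?C ?D" by (rule tm_conv[OF _ c wk_arr]) (rule assms)+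
  have C': "\<Delta> \<turnstile>\<^sub>T ?C[\<gamma>]\<^sub>T" "\<turnstile>\<^sub>c \<Delta> \<triangleright> ?C[\<gamma>]\<^sub>T" by (rule ty_subst_cong C assms extend_ty)+
  have CC: "\<Delta> \<turnstile>\<^sub>T ?C[\<gamma>]\<^sub>T \<approx> wk C \<Delta>" by (intro wk_subst assms)
  have lift: "\<Delta> \<triangleright> ?C[\<gamma>]\<^sub>T \<turnstile>\<^sub>s lift ?C \<gamma> : \<Gamma> \<triangleright> ?C" by (intro lift_ty assms C)
  have D': "\<Delta> \<triangleright> ?C[\<gamma>]\<^sub>T \<turnstile>\<^sub>T ?D[lift ?C \<gamma>]\<^sub>T" by (rule ty_subst_cong[OF D lift])
  have DD: "\<Delta> \<triangleright> ?C[\<gamma>]\<^sub>T \<turnstile>\<^sub>T ?D[lift ?C \<gamma>]\<^sub>T \<approx> wk D (\<Delta> \<triangleright> wk C \<Delta>)"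
    by (rule ty_trans[OF wk_subst[OF C(2) lift] wk_cong]) (intro assms extend_cong CC)+
  have a': "\<Delta> \<turnstile>\<^sub>t a[\<gamma>]\<^sub>t : ?C[\<gamma>]\<^sub>T" by (rule tm_subst_cong[OF a assms(3)])
  have "\<Delta> \<turnstile>\<^sub>t c[\<gamma>]\<^sub>t : TPi (?C[\<gamma>]\<^sub>T) (?D[lift ?C \<gamma>]\<^sub>T)"
    by (rule tm_conv[OF assms(2) tm_subst_cong[OF c' assms(3)] Pi_subst[OF C(1) D assms(3)]])
  from app_cong[OF CC DD this a']
  have "\<Delta> \<turnstile>\<^sub>t App (?C[\<gamma>]\<^sub>T) (?D[lift ?C \<gamma>]\<^sub>T) (c[\<gamma>]\<^sub>t) (a[\<gamma>]\<^sub>t) \<approx> fapp \<Delta> C D (c[\<gamma>]\<^sub>t) (a[\<gamma>]\<^sub>t) :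
      (?D[lift ?C \<gamma>]\<^sub>T)[\<langle>id\<^bsub>\<Delta>\<^esub>, a[\<gamma>]\<^sub>t\<rangle>\<^bsub>?C[\<gamma>]\<^sub>T\<^esub>]\<^sub>T" .
  moreover have i: "\<Delta> \<turnstile>\<^sub>s \<langle>id\<^bsub>\<Delta>\<^esub>, a[\<gamma>]\<^sub>t\<rangle>\<^bsub>?C[\<gamma>]\<^sub>T\<^esub> : \<Delta> \<triangleright> ?C[\<gamma>]\<^sub>T" by (intro inst_ty assms C' a')
  have "\<Delta> \<turnstile>\<^sub>T (?D[lift ?C \<gamma>]\<^sub>T)[\<langle>id\<^bsub>\<Delta>\<^esub>, a[\<gamma>]\<^sub>t\<rangle>\<^bsub>?C[\<gamma>]\<^sub>T\<^esub>]\<^sub>T \<approx> wk D \<Delta>"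
    by (rule ty_trans[OF ty_subst_cong[OF wk_subst[OF C(2) lift assms(5)] i] wk_subst[OF C'(2) i assms(5)]])
  ultimately have 1: "\<Delta> \<turnstile>\<^sub>t App (?C[\<gamma>]\<^sub>T) (?D[lift ?C \<gamma>]\<^sub>T) (c[\<gamma>]\<^sub>t) (a[\<gamma>]\<^sub>t) \<approx>
      fapp \<Delta> C D (c[\<gamma>]\<^sub>t) (a[\<gamma>]\<^sub>t) : wk D \<Delta>"
    by (rule tm_conv[OF assms(2)])
  have i': "\<Gamma> \<turnstile>\<^sub>s \<langle>id\<^bsub>\<Gamma>\<^esub>, a\<rangle>\<^bsub>?C\<^esub> : \<Gamma> \<triangleright> ?C" by (intro inst_ty assms C a)
  have "\<Delta> \<turnstile>\<^sub>T ?D[\<langle>id\<^bsub>\<Gamma>\<^esub>, a\<rangle>\<^bsub>?C\<^esub>]\<^sub>T[\<gamma>]\<^sub>T \<approx> wk D \<Delta>"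
    by (rule ty_trans[OF ty_subst_cong[OF wk_subst[OF C(2) i' assms(5)] assms(3)] wk_subst[OF assms(1,3,5)]])
  from tm_trans[OF tm_conv[OF assms(2) app_subst[OF C(1) D c' a assms(3)] this] 1] show ?thesis .
qed

lemma subst_spair_var:
  assumes "\<turnstile>\<^sub>c \<Gamma>" "\<turnstile>\<^sub>c \<Delta>" "\<Gamma> \<turnstile>\<^sub>T A" "\<Delta> \<turnstile>\<^sub>s \<gamma> : \<Gamma>" "\<Delta> \<turnstile>\<^sub>t a : A[\<gamma>]\<^sub>T" "Empty \<turnstile>\<^sub>T C" "\<Gamma> \<turnstile>\<^sub>t t : wk C \<Gamma>"
  shows "\<Delta> \<turnstile>\<^sub>t t[p\<^bsub>A\<^esub>]\<^sub>t[\<langle>\<gamma>, a\<rangle>\<^bsub>A\<^esub>]\<^sub>t \<approx> t[\<gamma>]\<^sub>t : wk C \<Delta>"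
proof (rule tm_conv[OF assms(2) _ wk_subst[OF assms(1,4,6)]])
  have p: "\<Gamma> \<triangleright> A \<turnstile>\<^sub>s p\<^bsub>A\<^esub> : \<Gamma>" by (rule p_cong assms)+
  have s: "\<Delta> \<turnstile>\<^sub>s \<langle>\<gamma>, a\<rangle>\<^bsub>A\<^esub> : \<Gamma> \<triangleright> A" by (rule spair_cong assms)+
  have ps: "\<Delta> \<turnstile>\<^sub>s p\<^bsub>A\<^esub> \<odot> \<langle>\<gamma>, a\<rangle>\<^bsub>A\<^esub> \<approx> \<gamma> : \<Gamma>" by (rule p_spair assms)+
  have T: "\<Delta> \<turnstile>\<^sub>T (wk C \<Gamma>)[p\<^bsub>A\<^esub> \<odot> \<langle>\<gamma>, a\<rangle>\<^bsub>A\<^esub>]\<^sub>T \<approx> (wk C \<Gamma>)[\<gamma>]\<^sub>T"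
    by (rule ty_subst_cong[OF wk_ty ps]) (rule assms)+
  have "\<Delta> \<turnstile>\<^sub>t t[p\<^bsub>A\<^esub>]\<^sub>t[\<langle>\<gamma>, a\<rangle>\<^bsub>A\<^esub>]\<^sub>t \<approx> t[p\<^bsub>A\<^esub> \<odot> \<langle>\<gamma>, a\<rangle>\<^bsub>A\<^esub>]\<^sub>t : (wk C \<Gamma>)[p\<^bsub>A\<^esub> \<odot> \<langle>\<gamma>, a\<rangle>\<^bsub>A\<^esub>]\<^sub>T"
    by (rule tm_sym[OF tm_subst_comp[OF assms(7) p s]])
  moreover have "\<Delta> \<turnstile>\<^sub>t t[p\<^bsub>A\<^esub> \<odot> \<langle>\<gamma>, a\<rangle>\<^bsub>A\<^esub>]\<^sub>t \<approx> t[\<gamma>]\<^sub>t : (wk C \<Gamma>)[p\<^bsub>A\<^esub> \<odot> \<langle>\<gamma>, a\<rangle>\<^bsub>A\<^esub>]\<^sub>T"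
    by (rule tm_subst_cong[OF assms(7) ps])
  ultimately show "\<Delta> \<turnstile>\<^sub>t t[p\<^bsub>A\<^esub>]\<^sub>t[\<langle>\<gamma>, a\<rangle>\<^bsub>A\<^esub>]\<^sub>t \<approx> t[\<gamma>]\<^sub>t : (wk C \<Gamma>)[\<gamma>]\<^sub>T"
    by (rule tm_conv[OF assms(2) tm_trans T])
qed

lemma wk_tm: "\<turnstile>\<^sub>c \<Gamma> \<Longrightarrow> \<turnstile>\<^sub>c \<Delta> \<Longrightarrow> \<Delta> \<turnstile>\<^sub>s \<gamma> : \<Gamma> \<Longrightarrow> Empty \<turnstile>\<^sub>T C \<Longrightarrow> \<Gamma> \<turnstile>\<^sub>t t \<approx> t' : wk C \<Gamma> \<Longrightarrow>
    \<Delta> \<turnstile>\<^sub>t t[\<gamma>]\<^sub>t \<approx> t'[\<gamma>]\<^sub>t : wk C \<Delta>"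
  by (rule tm_conv[OF _ tm_subst_cong wk_subst])

lemma q_wk: "\<turnstile>\<^sub>c \<Gamma> \<Longrightarrow> Empty \<turnstile>\<^sub>T C \<Longrightarrow> \<Gamma> \<triangleright> wk C \<Gamma> \<turnstile>\<^sub>t q\<^bsub>wk C \<Gamma>\<^esub> : wk C (\<Gamma> \<triangleright> wk C \<Gamma>)"
  by (rule tm_conv[OF _ q_cong wk_subst]) (blast intro: extend_ty wk_ty p_cong)+

text \<open>Not among the rules: it follows by applying \<open>spair_eta\<close> to the composite
  and computing both of its projections.\<close>

lemma spair_comp:
  assumes A: "\<Gamma> \<turnstile>\<^sub>T A" and g: "\<Delta> \<turnstile>\<^sub>s \<gamma> : \<Gamma>" and a: "\<Delta> \<turnstile>\<^sub>t a : A[\<gamma>]\<^sub>T" and d: "\<Xi> \<turnstile>\<^sub>s \<delta> : \<Delta>" and X: "\<turnstile>\<^sub>c \<Xi>"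
  shows "\<Xi> \<turnstile>\<^sub>s \<langle>\<gamma>, a\<rangle>\<^bsub>A\<^esub> \<odot> \<delta> \<approx> \<langle>\<gamma> \<odot> \<delta>, a[\<delta>]\<^sub>t\<rangle>\<^bsub>A\<^esub> : \<Gamma> \<triangleright> A"
proof -
  let ?s = "\<langle>\<gamma>, a\<rangle>\<^bsub>A\<^esub>"
  have p: "\<Gamma> \<triangleright> A \<turnstile>\<^sub>s p\<^bsub>A\<^esub> : \<Gamma>" by (rule p_cong A)+
  have q: "\<Gamma> \<triangleright> A \<turnstile>\<^sub>t q\<^bsub>A\<^esub> : A[p\<^bsub>A\<^esub>]\<^sub>T" by (rule q_cong A)+
  have s: "\<Delta> \<turnstile>\<^sub>s ?s : \<Gamma> \<triangleright> A" by (rule spair_cong A g a)+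
  have sd: "\<Xi> \<turnstile>\<^sub>s ?s \<odot> \<delta> : \<Gamma> \<triangleright> A" by (rule comp_cong s d)+
  have ps: "\<Delta> \<turnstile>\<^sub>s p\<^bsub>A\<^esub> \<odot> ?s \<approx> \<gamma> : \<Gamma>" by (rule p_spair A g a)+
  have 1: "\<Xi> \<turnstile>\<^sub>s p\<^bsub>A\<^esub> \<odot> (?s \<odot> \<delta>) \<approx> \<gamma> \<odot> \<delta> : \<Gamma>"
    by (rule sub_trans[OF sub_sym[OF comp_assoc[OF p s d]] comp_cong[OF d ps]])
  have T1: "\<Xi> \<turnstile>\<^sub>T A[p\<^bsub>A\<^esub>]\<^sub>T[?s \<odot> \<delta>]\<^sub>T \<approx> A[p\<^bsub>A\<^esub> \<odot> (?s \<odot> \<delta>)]\<^sub>T"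
    by (rule ty_sym[OF ty_subst_comp[OF A p sd]])
  have T2: "\<Xi> \<turnstile>\<^sub>T A[p\<^bsub>A\<^esub>]\<^sub>T[?s \<odot> \<delta>]\<^sub>T \<approx> A[\<gamma>]\<^sub>T[\<delta>]\<^sub>T"
    by (rule ty_trans[OF ty_trans[OF T1 ty_subst_cong[OF A 1]] ty_subst_comp[OF A g d]])
  have T3: "\<Delta> \<turnstile>\<^sub>T A[p\<^bsub>A\<^esub>]\<^sub>T[?s]\<^sub>T \<approx> A[\<gamma>]\<^sub>T"
    by (rule ty_trans[OF ty_sym[OF ty_subst_comp[OF A p s]] ty_subst_cong[OF A ps]])
  have "\<Xi> \<turnstile>\<^sub>t q\<^bsub>A\<^esub>[?s \<odot> \<delta>]\<^sub>t \<approx> q\<^bsub>A\<^esub>[?s]\<^sub>t[\<delta>]\<^sub>t : A[p\<^bsub>A\<^esub>]\<^sub>T[?s \<odot> \<delta>]\<^sub>T"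
    by (rule tm_subst_comp[OF q s d])
  then have "\<Xi> \<turnstile>\<^sub>t q\<^bsub>A\<^esub>[?s \<odot> \<delta>]\<^sub>t \<approx> q\<^bsub>A\<^esub>[?s]\<^sub>t[\<delta>]\<^sub>t : A[\<gamma>]\<^sub>T[\<delta>]\<^sub>T" by (rule tm_conv[OF X _ T2])
  moreover have "\<Xi> \<turnstile>\<^sub>t q\<^bsub>A\<^esub>[?s]\<^sub>t[\<delta>]\<^sub>t \<approx> a[\<delta>]\<^sub>t : A[\<gamma>]\<^sub>T[\<delta>]\<^sub>T"
    by (rule tm_subst_cong[OF q_spair[OF A g a] d])
  ultimately have 2: "\<Xi> \<turnstile>\<^sub>t q\<^bsub>A\<^esub>[?s \<odot> \<delta>]\<^sub>t \<approx> a[\<delta>]\<^sub>t : A[p\<^bsub>A\<^esub> \<odot> (?s \<odot> \<delta>)]\<^sub>T"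
    by (rule tm_conv[OF X tm_trans ty_trans[OF ty_sym[OF T2] T1]])
  show ?thesis
    by (rule sub_trans[OF spair_eta[OF A sd] spair_cong[OF A 1 2]])
qed

text \<open>This turns the codomain \<open>B\<close> lifted along \<open>\<gamma>\<close> and then
  instantiated, as produced by \<open>Pi_subst\<close> and \<open>app_cong\<close>, into
  \<open>B\<close> at the extended substitution.\<close>

lemma lift_inst:
  assumes A: "\<Gamma> \<turnstile>\<^sub>T A" and g: "\<Delta> \<turnstile>\<^sub>s \<gamma> : \<Gamma>" and a: "\<Delta> \<turnstile>\<^sub>t a : A[\<gamma>]\<^sub>T" and D: "\<turnstile>\<^sub>c \<Delta>"
  shows "\<Delta> \<turnstile>\<^sub>s lift A \<gamma> \<odot> \<langle>id\<^bsub>\<Delta>\<^esub>, a\<rangle>\<^bsub>A[\<gamma>]\<^sub>T\<^esub> \<approx> \<langle>\<gamma>, a\<rangle>\<^bsub>A\<^esub> : \<Gamma> \<triangleright> A"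
proof -
  let ?A = "A[\<gamma>]\<^sub>T" let ?i = "\<langle>id\<^bsub>\<Delta>\<^esub>, a\<rangle>\<^bsub>?A\<^esub>"
  have A': "\<Delta> \<turnstile>\<^sub>T ?A" by (rule ty_subst_cong A g)+
  have i: "\<Delta> \<turnstile>\<^sub>s ?i : \<Delta> \<triangleright> ?A" by (rule inst_ty D A' a)+
  have id: "\<Delta> \<turnstile>\<^sub>s id\<^bsub>\<Delta>\<^esub> : \<Delta>" by (rule id_cong D)+
  have ai: "\<Delta> \<turnstile>\<^sub>t a : ?A[id\<^bsub>\<Delta>\<^esub>]\<^sub>T" by (rule tm_conv[OF D a ty_sym[OF ty_subst_id[OF A']]])
  have p: "\<Delta> \<triangleright> ?A \<turnstile>\<^sub>s p\<^bsub>?A\<^esub> : \<Delta>" by (rule p_cong A')+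
  have gp: "\<Delta> \<triangleright> ?A \<turnstile>\<^sub>s \<gamma> \<odot> p\<^bsub>?A\<^esub> : \<Gamma>" by (rule comp_cong p g)+
  have q: "\<Delta> \<triangleright> ?A \<turnstile>\<^sub>t q\<^bsub>?A\<^esub> : A[\<gamma> \<odot> p\<^bsub>?A\<^esub>]\<^sub>T"
    by (rule tm_conv[OF extend_ty[OF D A'] q_cong[OF A'] ty_sym[OF ty_subst_comp[OF A g p]]])
  have 1: "\<Delta> \<turnstile>\<^sub>s (\<gamma> \<odot> p\<^bsub>?A\<^esub>) \<odot> ?i \<approx> \<gamma> : \<Gamma>"
    by (rule sub_trans[OF comp_assoc[OF g p i]
        sub_trans[OF comp_cong[OF p_spair[OF A' id ai] g] sub_sym[OF id_right[OF g]]]])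
  have 2: "\<Delta> \<turnstile>\<^sub>t q\<^bsub>?A\<^esub>[?i]\<^sub>t \<approx> a : A[(\<gamma> \<odot> p\<^bsub>?A\<^esub>) \<odot> ?i]\<^sub>T"
    by (rule tm_conv[OF D q_spair[OF A' id ai] ty_trans[OF ty_subst_id[OF A'] ty_sym[OF ty_subst_cong[OF A 1]]]])
  show ?thesis by (rule sub_trans[OF spair_comp[OF A gp q i D] spair_cong[OF A 1 2]])
qed

text \<open>The witness is an application. It is hidden by the quantifier because reflection needs
  only some inhabitant of an instance of a law.\<close>

lemma Pi_inst:
  assumes D: "\<turnstile>\<^sub>c \<Delta>" and A: "\<Gamma> \<turnstile>\<^sub>T A" and B: "\<Gamma> \<triangleright> A \<turnstile>\<^sub>T B" and g: "\<Delta> \<turnstile>\<^sub>s \<gamma> : \<Gamma>"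
    and c: "\<Delta> \<turnstile>\<^sub>t c : (TPi A B)[\<gamma>]\<^sub>T" and a: "\<Delta> \<turnstile>\<^sub>t a : A[\<gamma>]\<^sub>T"
  shows "\<exists>c'. \<Delta> \<turnstile>\<^sub>t c' : B[\<langle>\<gamma>, a\<rangle>\<^bsub>A\<^esub>]\<^sub>T"
proof
  let ?i = "\<langle>id\<^bsub>\<Delta>\<^esub>, a\<rangle>\<^bsub>A[\<gamma>]\<^sub>T\<^esub>"
  have A': "\<Delta> \<turnstile>\<^sub>T A[\<gamma>]\<^sub>T" by (rule ty_subst_cong A g)+
  have l: "\<Delta> \<triangleright> A[\<gamma>]\<^sub>T \<turnstile>\<^sub>s lift A \<gamma> : \<Gamma> \<triangleright> A" by (rule lift_ty[OF D g A])
  have i: "\<Delta> \<turnstile>\<^sub>s ?i : \<Delta> \<triangleright> A[\<gamma>]\<^sub>T" by (rule inst_ty D A' a)+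
  have "\<Delta> \<turnstile>\<^sub>t App (A[\<gamma>]\<^sub>T) (B[lift A \<gamma>]\<^sub>T) c a : B[lift A \<gamma>]\<^sub>T[?i]\<^sub>T"
    by (rule app_cong[OF A' ty_subst_cong[OF B l] tm_conv[OF D c Pi_subst[OF A B g]] a])
  moreover have "\<Delta> \<turnstile>\<^sub>T B[lift A \<gamma>]\<^sub>T[?i]\<^sub>T \<approx> B[\<langle>\<gamma>, a\<rangle>\<^bsub>A\<^esub>]\<^sub>T"
    by (rule ty_trans[OF ty_sym[OF ty_subst_comp[OF B l i]] ty_subst_cong[OF B lift_inst[OF A g a D]]])
  ultimately show "\<Delta> \<turnstile>\<^sub>t App (A[\<gamma>]\<^sub>T) (B[lift A \<gamma>]\<^sub>T) c a : B[\<langle>\<gamma>, a\<rangle>\<^bsub>A\<^esub>]\<^sub>T"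
    by (rule tm_conv[OF D])
qed

section \<open>The two combinatory laws as types over a binary operation\<close>

abbreviation obj :: "ctx \<Rightarrow> ty" where "obj \<Gamma> \<equiv> wk TBase \<Gamma>"
abbreviation binop :: ty where "binop \<equiv> arr TBase (arr TBase TBase)"
abbreviation xt :: "ctx \<Rightarrow> ctx" where "xt \<Gamma> \<equiv> \<Gamma> \<triangleright> obj \<Gamma>"
abbreviation up :: "ctx \<Rightarrow> tm \<Rightarrow> tm" where "up \<Gamma> t \<equiv> t[p\<^bsub>obj \<Gamma>\<^esub>]\<^sub>t"
abbreviation var :: "ctx \<Rightarrow> tm" where "var \<Gamma> \<equiv> q\<^bsub>obj \<Gamma>\<^esub>"
abbreviation snoc :: "ctx \<Rightarrow> sub \<Rightarrow> tm \<Rightarrow> sub" where "snoc \<Gamma> \<gamma> a \<equiv> \<langle>\<gamma>, a\<rangle>\<^bsub>obj \<Gamma>\<^esub>"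

definition ap2 :: "ctx \<Rightarrow> tm \<Rightarrow> tm \<Rightarrow> tm \<Rightarrow> tm" where
  "ap2 \<Gamma> P a b = fapp \<Gamma> TBase TBase (fapp \<Gamma> TBase (arr TBase TBase) P a) b"

lemma binop_ty: "Empty \<turnstile>\<^sub>T arr TBase TBase" "Empty \<turnstile>\<^sub>T binop"
  by (intro arr_ty base_cong)+

lemma ap2_cong:
  assumes "\<turnstile>\<^sub>c \<Gamma>" "\<Gamma> \<turnstile>\<^sub>t P \<approx> P' : wk binop \<Gamma>" "\<Gamma> \<turnstile>\<^sub>t a \<approx> a' : obj \<Gamma>" "\<Gamma> \<turnstile>\<^sub>t b \<approx> b' : obj \<Gamma>"
  shows "\<Gamma> \<turnstile>\<^sub>t ap2 \<Gamma> P a b \<approx> ap2 \<Gamma> P' a' b' : obj \<Gamma>"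
  unfolding ap2_def by (intro fapp_cong assms base_cong binop_ty)

lemma ap2_subst:
  assumes "\<turnstile>\<^sub>c \<Gamma>" "\<turnstile>\<^sub>c \<Delta>" "\<Delta> \<turnstile>\<^sub>s \<gamma> : \<Gamma>"
    and "\<Gamma> \<turnstile>\<^sub>t P : wk binop \<Gamma>" "\<Gamma> \<turnstile>\<^sub>t a : obj \<Gamma>" "\<Gamma> \<turnstile>\<^sub>t b : obj \<Gamma>"
    and "\<Delta> \<turnstile>\<^sub>t P[\<gamma>]\<^sub>t \<approx> P' : wk binop \<Delta>" "\<Delta> \<turnstile>\<^sub>t a[\<gamma>]\<^sub>t \<approx> a' : obj \<Delta>" "\<Delta> \<turnstile>\<^sub>t b[\<gamma>]\<^sub>t \<approx> b' : obj \<Delta>"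
  shows "\<Delta> \<turnstile>\<^sub>t (ap2 \<Gamma> P a b)[\<gamma>]\<^sub>t \<approx> ap2 \<Delta> P' a' b' : obj \<Delta>"
  unfolding ap2_def
  by (rule tm_trans[OF fapp_subst fapp_cong])
    (intro assms base_cong binop_ty fapp_cong
      tm_trans[OF fapp_subst[OF assms(1-3) base_cong binop_ty(1) assms(4,5)] fapp_cong])+

lemma obj_ty: "\<turnstile>\<^sub>c \<Gamma> \<Longrightarrow> \<Gamma> \<turnstile>\<^sub>T obj \<Gamma>"
  by (intro wk_ty base_cong)

lemma xt_ctx: "\<turnstile>\<^sub>c \<Gamma> \<Longrightarrow> \<turnstile>\<^sub>c xt \<Gamma>"
  by (intro extend_ty obj_ty)

lemma up_ty: "\<turnstile>\<^sub>c \<Gamma> \<Longrightarrow> Empty \<turnstile>\<^sub>T C \<Longrightarrow> \<Gamma> \<turnstile>\<^sub>t t : wk C \<Gamma> \<Longrightarrow> xt \<Gamma> \<turnstile>\<^sub>t up \<Gamma> t : wk C (xt \<Gamma>)"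
  by (rule wk_tm[OF _ xt_ctx p_cong[OF obj_ty]])

lemma var_ty: "\<turnstile>\<^sub>c \<Gamma> \<Longrightarrow> xt \<Gamma> \<turnstile>\<^sub>t var \<Gamma> : obj (xt \<Gamma>)"
  by (intro q_wk base_cong)

lemma obj_subst: "\<turnstile>\<^sub>c \<Gamma> \<Longrightarrow> \<Delta> \<turnstile>\<^sub>s \<gamma> : \<Gamma> \<Longrightarrow> \<Delta> \<turnstile>\<^sub>T (obj \<Gamma>)[\<gamma>]\<^sub>T \<approx> obj \<Delta>"
  by (intro wk_subst base_cong)

lemma obj_tm: "\<turnstile>\<^sub>c \<Gamma> \<Longrightarrow> \<turnstile>\<^sub>c \<Delta> \<Longrightarrow> \<Delta> \<turnstile>\<^sub>s \<gamma> : \<Gamma> \<Longrightarrow> \<Delta> \<turnstile>\<^sub>t a : obj \<Delta> \<Longrightarrow> \<Delta> \<turnstile>\<^sub>t a : (obj \<Gamma>)[\<gamma>]\<^sub>T"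
  by (rule tm_conv[OF _ _ ty_sym[OF obj_subst]])

lemma snoc_ty: "\<turnstile>\<^sub>c \<Gamma> \<Longrightarrow> \<turnstile>\<^sub>c \<Delta> \<Longrightarrow> \<Delta> \<turnstile>\<^sub>s \<gamma> : \<Gamma> \<Longrightarrow> \<Delta> \<turnstile>\<^sub>t a : obj \<Delta> \<Longrightarrow> \<Delta> \<turnstile>\<^sub>s snoc \<Gamma> \<gamma> a : xt \<Gamma>"
  by (intro spair_cong obj_tm obj_ty)

lemma var_snoc: "\<turnstile>\<^sub>c \<Gamma> \<Longrightarrow> \<turnstile>\<^sub>c \<Delta> \<Longrightarrow> \<Delta> \<turnstile>\<^sub>s \<gamma> : \<Gamma> \<Longrightarrow> \<Delta> \<turnstile>\<^sub>t a : obj \<Delta> \<Longrightarrow>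
    \<Delta> \<turnstile>\<^sub>t (var \<Gamma>)[snoc \<Gamma> \<gamma> a]\<^sub>t \<approx> a : obj \<Delta>"
  by (rule tm_conv[OF _ q_spair[OF obj_ty] obj_subst]) (blast intro: obj_tm)+

lemma up_snoc: "\<turnstile>\<^sub>c \<Gamma> \<Longrightarrow> \<turnstile>\<^sub>c \<Delta> \<Longrightarrow> \<Delta> \<turnstile>\<^sub>s \<gamma> : \<Gamma> \<Longrightarrow> \<Delta> \<turnstile>\<^sub>t a : obj \<Delta> \<Longrightarrow> Empty \<turnstile>\<^sub>T C \<Longrightarrow>
    \<Gamma> \<turnstile>\<^sub>t t : wk C \<Gamma> \<Longrightarrow> \<Delta> \<turnstile>\<^sub>t t[\<gamma>]\<^sub>t \<approx> t' : wk C \<Delta> \<Longrightarrow>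
    \<Delta> \<turnstile>\<^sub>t (up \<Gamma> t)[snoc \<Gamma> \<gamma> a]\<^sub>t \<approx> t' : wk C \<Delta>"
  by (rule tm_trans[OF subst_spair_var[where \<Gamma> = \<Gamma>]]) (blast intro: obj_ty obj_tm)+

lemma forall_inst:
  assumes "\<turnstile>\<^sub>c \<Delta>" "\<turnstile>\<^sub>c \<Gamma>" "xt \<Gamma> \<turnstile>\<^sub>T B" "\<Delta> \<turnstile>\<^sub>s \<gamma> : \<Gamma>" "\<Delta> \<turnstile>\<^sub>t c : (TPi (obj \<Gamma>) B)[\<gamma>]\<^sub>T" "\<Delta> \<turnstile>\<^sub>t a : obj \<Delta>"
  obtains c' where "\<Delta> \<turnstile>\<^sub>t c' : B[snoc \<Gamma> \<gamma> a]\<^sub>T"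
  using Pi_inst[OF assms(1) obj_ty[OF assms(2)] assms(3-5) obj_tm[OF assms(2,1,4,6)]] by blast

text \<open>Extensionality enters here: \<open>I_subst\<close> exposes the identity type beneath the
  substitution, and \<open>reflection\<close> turns its inhabitant into an equality of
  terms.\<close>

lemma TId_inst:
  assumes "\<turnstile>\<^sub>c \<Delta>" "\<turnstile>\<^sub>c \<Gamma>" "\<Delta> \<turnstile>\<^sub>s \<gamma> : \<Gamma>" "\<Gamma> \<turnstile>\<^sub>t t : obj \<Gamma>" "\<Gamma> \<turnstile>\<^sub>t u : obj \<Gamma>" "\<Delta> \<turnstile>\<^sub>t c : (TId (obj \<Gamma>) t u)[\<gamma>]\<^sub>T"
  shows "\<Delta> \<turnstile>\<^sub>t t[\<gamma>]\<^sub>t \<approx> u[\<gamma>]\<^sub>t : obj \<Delta>"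
  by (rule tm_conv[OF assms(1) reflection[OF tm_conv[OF assms(1,6) I_subst[OF obj_ty[OF assms(2)] assms(4,5,3)]]]
    obj_subst[OF assms(2,3)]])

definition K_body :: "ctx \<Rightarrow> tm \<Rightarrow> tm \<Rightarrow> ty" where
  "K_body \<Gamma> P k = (let \<Gamma>1 = xt \<Gamma>; \<Gamma>2 = xt \<Gamma>1; P = up \<Gamma>1 (up \<Gamma> P); k = up \<Gamma>1 (up \<Gamma> k);
     x = up \<Gamma>1 (var \<Gamma>); y = var \<Gamma>1
   in TId (obj \<Gamma>2) (ap2 \<Gamma>2 P (ap2 \<Gamma>2 P k x) y) x)"

definition K_law :: "ctx \<Rightarrow> tm \<Rightarrow> tm \<Rightarrow> ty" where
  "K_law \<Gamma> P k = TPi (obj \<Gamma>) (TPi (obj (xt \<Gamma>)) (K_body \<Gamma> P k))"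

definition S_body :: "ctx \<Rightarrow> tm \<Rightarrow> tm \<Rightarrow> ty" where
  "S_body \<Gamma> P s = (let \<Gamma>1 = xt \<Gamma>; \<Gamma>2 = xt \<Gamma>1; \<Gamma>3 = xt \<Gamma>2;
     P = up \<Gamma>2 (up \<Gamma>1 (up \<Gamma> P)); s = up \<Gamma>2 (up \<Gamma>1 (up \<Gamma> s));
     x = up \<Gamma>2 (up \<Gamma>1 (var \<Gamma>)); y = up \<Gamma>2 (var \<Gamma>1); z = var \<Gamma>2
   in TId (obj \<Gamma>3) (ap2 \<Gamma>3 P (ap2 \<Gamma>3 P (ap2 \<Gamma>3 P s x) y) z)
     (ap2 \<Gamma>3 P (ap2 \<Gamma>3 P x z) (ap2 \<Gamma>3 P y z)))"

definition S_law :: "ctx \<Rightarrow> tm \<Rightarrow> tm \<Rightarrow> ty" where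
  "S_law \<Gamma> P s = TPi (obj \<Gamma>) (TPi (obj (xt \<Gamma>)) (TPi (obj (xt (xt \<Gamma>))) (S_body \<Gamma> P s)))"

lemmas op_tys = base_cong binop_ty(2)

lemma K_body_ty:
  assumes "\<turnstile>\<^sub>c \<Gamma>" "\<Gamma> \<turnstile>\<^sub>t P : wk binop \<Gamma>" "\<Gamma> \<turnstile>\<^sub>t k : obj \<Gamma>"
  shows "xt (xt \<Gamma>) \<turnstile>\<^sub>T K_body \<Gamma> P k"
  unfolding K_body_def Let_def by (intro I_cong ap2_cong obj_ty xt_ctx up_ty var_ty assms op_tys)

lemma S_body_ty:
  assumes "\<turnstile>\<^sub>c \<Gamma>" "\<Gamma> \<turnstile>\<^sub>t P : wk binop \<Gamma>" "\<Gamma> \<turnstile>\<^sub>t s : obj \<Gamma>"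
  shows "xt (xt (xt \<Gamma>)) \<turnstile>\<^sub>T S_body \<Gamma> P s"
  unfolding S_body_def Let_def by (intro I_cong ap2_cong obj_ty xt_ctx up_ty var_ty assms op_tys)

lemma K_law_ty:
  assumes "\<turnstile>\<^sub>c \<Gamma>" "\<Gamma> \<turnstile>\<^sub>t P : wk binop \<Gamma>" "\<Gamma> \<turnstile>\<^sub>t k : obj \<Gamma>"
  shows "\<Gamma> \<turnstile>\<^sub>T K_law \<Gamma> P k"
  unfolding K_law_def by (intro Pi_cong obj_ty xt_ctx K_body_ty assms)

lemma S_law_ty:
  assumes "\<turnstile>\<^sub>c \<Gamma>" "\<Gamma> \<turnstile>\<^sub>t P : wk binop \<Gamma>" "\<Gamma> \<turnstile>\<^sub>t s : obj \<Gamma>"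
  shows "\<Gamma> \<turnstile>\<^sub>T S_law \<Gamma> P s"
  unfolding S_law_def by (intro Pi_cong obj_ty xt_ctx S_body_ty assms)

text \<open>Each quantifier extends the substitution by one argument. Under the final substitution
  the weakenings of \<open>P\<close> and \<open>k\<close> cancel by \<open>up_snoc\<close>, and the
  two variables become \<open>a\<close> and \<open>b\<close>.\<close>

lemma K_law_inst:
  assumes "\<turnstile>\<^sub>c \<Gamma>" "\<turnstile>\<^sub>c \<Delta>" "\<Delta> \<turnstile>\<^sub>s \<gamma> : \<Gamma>" "\<Gamma> \<turnstile>\<^sub>t P : wk binop \<Gamma>" "\<Gamma> \<turnstile>\<^sub>t k : obj \<Gamma>"
    and e: "\<Delta> \<turnstile>\<^sub>t e : (K_law \<Gamma> P k)[\<gamma>]\<^sub>T" and "\<Delta> \<turnstile>\<^sub>t a : obj \<Delta>" "\<Delta> \<turnstile>\<^sub>t b : obj \<Delta>"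
  shows "\<Delta> \<turnstile>\<^sub>t ap2 \<Delta> (P[\<gamma>]\<^sub>t) (ap2 \<Delta> (P[\<gamma>]\<^sub>t) (k[\<gamma>]\<^sub>t) a) b \<approx> a : obj \<Delta>"
proof -
  let ?X = "xt \<Gamma>" let ?Y = "xt ?X"
  let ?g = "snoc \<Gamma> \<gamma> a" let ?h = "snoc ?X ?g b"
  have X: "\<turnstile>\<^sub>c ?X" "\<turnstile>\<^sub>c ?Y" by (intro xt_ctx assms)+
  have g: "\<Delta> \<turnstile>\<^sub>s ?g : ?X" "\<Delta> \<turnstile>\<^sub>s ?h : ?Y" by (intro snoc_ty assms X)+
  have Y: "?X \<turnstile>\<^sub>T TPi (obj ?X) (K_body \<Gamma> P k)" by (intro Pi_cong obj_ty X K_body_ty assms)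
  obtain e1 where e1: "\<Delta> \<turnstile>\<^sub>t e1 : (TPi (obj ?X) (K_body \<Gamma> P k))[?g]\<^sub>T"
    using forall_inst[OF assms(2,1) Y assms(3) e[unfolded K_law_def] assms(7)] by blast
  obtain e2 where e2: "\<Delta> \<turnstile>\<^sub>t e2 : (K_body \<Gamma> P k)[?h]\<^sub>T"
    using forall_inst[OF assms(2) X(1) K_body_ty[OF assms(1,4,5)] g(1) e1 assms(8)] by blast
  let ?P = "up ?X (up \<Gamma> P)" let ?k = "up ?X (up \<Gamma> k)" let ?x = "up ?X (var \<Gamma>)" let ?y = "var ?X"
  let ?l = "ap2 ?Y ?P (ap2 ?Y ?P ?k ?x) ?y"
  have ty: "?Y \<turnstile>\<^sub>t ?P : wk binop ?Y" "?Y \<turnstile>\<^sub>t ?k : obj ?Y" "?Y \<turnstile>\<^sub>t ?x : obj ?Y" "?Y \<turnstile>\<^sub>t ?y : obj ?Y"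
    by (intro up_ty var_ty X assms op_tys)+
  have l: "?Y \<turnstile>\<^sub>t ?l : obj ?Y" by (intro ap2_cong ty X)
  have 1: "\<Delta> \<turnstile>\<^sub>t ?l[?h]\<^sub>t \<approx> ?x[?h]\<^sub>t : obj \<Delta>"
    by (rule TId_inst[OF assms(2) X(2) g(2) l ty(3) e2[unfolded K_body_def Let_def]])
  have P: "\<Delta> \<turnstile>\<^sub>t ?P[?h]\<^sub>t \<approx> P[\<gamma>]\<^sub>t : wk binop \<Delta>"
    by (intro up_snoc up_ty X assms g op_tys wk_tm[OF assms(1,2,3)])
  have k: "\<Delta> \<turnstile>\<^sub>t ?k[?h]\<^sub>t \<approx> k[\<gamma>]\<^sub>t : obj \<Delta>"
    by (intro up_snoc up_ty X assms g op_tys wk_tm[OF assms(1,2,3)])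
  have x: "\<Delta> \<turnstile>\<^sub>t ?x[?h]\<^sub>t \<approx> a : obj \<Delta>"
    by (intro up_snoc var_snoc var_ty X assms g op_tys)
  have y: "\<Delta> \<turnstile>\<^sub>t ?y[?h]\<^sub>t \<approx> b : obj \<Delta>"
    by (intro var_snoc X assms g)
  have "\<Delta> \<turnstile>\<^sub>t ?l[?h]\<^sub>t \<approx> ap2 \<Delta> (P[\<gamma>]\<^sub>t) (ap2 \<Delta> (P[\<gamma>]\<^sub>t) (k[\<gamma>]\<^sub>t) a) b : obj \<Delta>"
    by (intro ap2_subst ap2_cong X assms g ty P k x y)
  from tm_trans[OF tm_sym[OF this] tm_trans[OF 1 x]] show ?thesis .
qed

lemma S_law_inst:
  assumes "\<turnstile>\<^sub>c \<Gamma>" "\<turnstile>\<^sub>c \<Delta>" "\<Delta> \<turnstile>\<^sub>s \<gamma> : \<Gamma>" "\<Gamma> \<turnstile>\<^sub>t P : wk binop \<Gamma>" "\<Gamma> \<turnstile>\<^sub>t s : obj \<Gamma>"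
    and e: "\<Delta> \<turnstile>\<^sub>t e : (S_law \<Gamma> P s)[\<gamma>]\<^sub>T" and "\<Delta> \<turnstile>\<^sub>t a : obj \<Delta>" "\<Delta> \<turnstile>\<^sub>t b : obj \<Delta>" "\<Delta> \<turnstile>\<^sub>t c : obj \<Delta>"
  defines "A \<equiv> ap2 \<Delta> (P[\<gamma>]\<^sub>t)"
  shows "\<Delta> \<turnstile>\<^sub>t A (A (A (s[\<gamma>]\<^sub>t) a) b) c \<approx> A (A a c) (A b c) : obj \<Delta>"
proof -
  let ?X = "xt \<Gamma>" let ?Y = "xt ?X" let ?Z = "xt ?Y"
  let ?g = "snoc \<Gamma> \<gamma> a" let ?h = "snoc ?X ?g b" let ?i = "snoc ?Y ?h c"
  have X: "\<turnstile>\<^sub>c ?X" "\<turnstile>\<^sub>c ?Y" "\<turnstile>\<^sub>c ?Z" by (intro xt_ctx assms)+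
  have g: "\<Delta> \<turnstile>\<^sub>s ?g : ?X" "\<Delta> \<turnstile>\<^sub>s ?h : ?Y" "\<Delta> \<turnstile>\<^sub>s ?i : ?Z" by (intro snoc_ty assms X)+
  have B2: "?Y \<turnstile>\<^sub>T TPi (obj ?Y) (S_body \<Gamma> P s)" by (intro Pi_cong obj_ty X S_body_ty assms)
  have B1: "?X \<turnstile>\<^sub>T TPi (obj ?X) (TPi (obj ?Y) (S_body \<Gamma> P s))" by (intro Pi_cong obj_ty X B2)
  obtain e1 where e1: "\<Delta> \<turnstile>\<^sub>t e1 : (TPi (obj ?X) (TPi (obj ?Y) (S_body \<Gamma> P s)))[?g]\<^sub>T"
    using forall_inst[OF assms(2,1) B1 assms(3) e[unfolded S_law_def] assms(7)] by blast
  obtain e2 where e2: "\<Delta> \<turnstile>\<^sub>t e2 : (TPi (obj ?Y) (S_body \<Gamma> P s))[?h]\<^sub>T"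
    using forall_inst[OF assms(2) X(1) B2 g(1) e1 assms(8)] by blast
  obtain e3 where e3: "\<Delta> \<turnstile>\<^sub>t e3 : (S_body \<Gamma> P s)[?i]\<^sub>T"
    using forall_inst[OF assms(2) X(2) S_body_ty[OF assms(1,4,5)] g(2) e2 assms(9)] by blast
  let ?P = "up ?Y (up ?X (up \<Gamma> P))" let ?s = "up ?Y (up ?X (up \<Gamma> s))"
  let ?x = "up ?Y (up ?X (var \<Gamma>))" let ?y = "up ?Y (var ?X)" let ?z = "var ?Y"
  let ?A = "ap2 ?Z ?P"
  let ?l = "?A (?A (?A ?s ?x) ?y) ?z" let ?r = "?A (?A ?x ?z) (?A ?y ?z)"
  have ty: "?Z \<turnstile>\<^sub>t ?P : wk binop ?Z" "?Z \<turnstile>\<^sub>t ?s : obj ?Z" "?Z \<turnstile>\<^sub>t ?x : obj ?Z" "?Z \<turnstile>\<^sub>t ?y : obj ?Z"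
    "?Z \<turnstile>\<^sub>t ?z : obj ?Z"
    by (intro up_ty var_ty X assms op_tys)+
  have l: "?Z \<turnstile>\<^sub>t ?l : obj ?Z" "?Z \<turnstile>\<^sub>t ?r : obj ?Z" by (intro ap2_cong ty X)+
  have 1: "\<Delta> \<turnstile>\<^sub>t ?l[?i]\<^sub>t \<approx> ?r[?i]\<^sub>t : obj \<Delta>"
    by (rule TId_inst[OF assms(2) X(3) g(3) l e3[unfolded S_body_def Let_def]])
  have P: "\<Delta> \<turnstile>\<^sub>t ?P[?i]\<^sub>t \<approx> P[\<gamma>]\<^sub>t : wk binop \<Delta>"
    by (intro up_snoc up_ty X assms g op_tys wk_tm[OF assms(1,2,3)])
  have s: "\<Delta> \<turnstile>\<^sub>t ?s[?i]\<^sub>t \<approx> s[\<gamma>]\<^sub>t : obj \<Delta>"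
    by (intro up_snoc up_ty X assms g op_tys wk_tm[OF assms(1,2,3)])
  have x: "\<Delta> \<turnstile>\<^sub>t ?x[?i]\<^sub>t \<approx> a : obj \<Delta>"
    by (intro up_snoc up_ty var_snoc var_ty X assms g op_tys)
  have y: "\<Delta> \<turnstile>\<^sub>t ?y[?i]\<^sub>t \<approx> b : obj \<Delta>"
    by (intro up_snoc var_snoc var_ty X assms g op_tys)
  have z: "\<Delta> \<turnstile>\<^sub>t ?z[?i]\<^sub>t \<approx> c : obj \<Delta>"
    by (intro var_snoc X assms g)
  have "\<Delta> \<turnstile>\<^sub>t ?l[?i]\<^sub>t \<approx> A (A (A (s[\<gamma>]\<^sub>t) a) b) c : obj \<Delta>" unfolding A_def
    by (intro ap2_subst ap2_cong X assms(1-9) g ty P s x y z)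
  moreover have "\<Delta> \<turnstile>\<^sub>t ?r[?i]\<^sub>t \<approx> A (A a c) (A b c) : obj \<Delta>" unfolding A_def
    by (intro ap2_subst ap2_cong X assms(1-9) g ty P s x y z)
  ultimately show ?thesis using 1 by (blast intro: tm_sym tm_trans)
qed

section \<open>The context of a generic combinatory algebra\<close>

definition "op_ctx = Empty \<triangleright> wk binop Empty"
definition "sig_ctx = xt (xt op_ctx)"
definition "op_app = up (xt op_ctx) (up op_ctx q\<^bsub>wk binop Empty\<^esub>)"
definition "op_K = up (xt op_ctx) (var op_ctx)"
definition "op_S = var (xt op_ctx)"
definition "K_ax = K_law sig_ctx op_app op_K"
text \<open>The \<open>S\<close> law is stated over the signature and weakened past the proof of the
  \<open>K\<close> law. In \<open>cl_ctx\<close> both laws are therefore types over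
  \<open>sig_ctx\<close> substituted along \<open>to_sig\<close>.\<close>

definition "S_ax = (S_law sig_ctx op_app op_S)[p\<^bsub>K_ax\<^esub>]\<^sub>T"
definition "cl_ctx = sig_ctx \<triangleright> K_ax \<triangleright> S_ax"
definition "to_sig = p\<^bsub>K_ax\<^esub> \<odot> p\<^bsub>S_ax\<^esub>"

primrec cl_tm :: "cl \<Rightarrow> tm" where
  "cl_tm CK = op_K[to_sig]\<^sub>t"
| "cl_tm CS = op_S[to_sig]\<^sub>t"
| "cl_tm (CApp t u) = ap2 cl_ctx (op_app[to_sig]\<^sub>t) (cl_tm t) (cl_tm u)"

lemma op_ctx_wf: "\<turnstile>\<^sub>c op_ctx"
  unfolding op_ctx_def by (intro extend_ty wk_ty empty_cong binop_ty)

lemma sig_ctx_wf: "\<turnstile>\<^sub>c sig_ctx"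
  unfolding sig_ctx_def by (intro xt_ctx op_ctx_wf)

lemma sig_ops_ty: "sig_ctx \<turnstile>\<^sub>t op_app : wk binop sig_ctx" "sig_ctx \<turnstile>\<^sub>t op_K : obj sig_ctx" "sig_ctx \<turnstile>\<^sub>t op_S : obj sig_ctx"
proof -
  have "op_ctx \<turnstile>\<^sub>t q\<^bsub>wk binop Empty\<^esub> : wk binop op_ctx"
    unfolding op_ctx_def by (intro q_wk empty_cong binop_ty)
  then show "sig_ctx \<turnstile>\<^sub>t op_app : wk binop sig_ctx" "sig_ctx \<turnstile>\<^sub>t op_K : obj sig_ctx" "sig_ctx \<turnstile>\<^sub>t op_S : obj sig_ctx"
    unfolding sig_ctx_def op_app_def op_K_def op_S_def by (intro up_ty var_ty xt_ctx op_ctx_wf op_tys; assumption)+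
qed

lemma axioms_ty: "sig_ctx \<turnstile>\<^sub>T K_ax" "sig_ctx \<triangleright> K_ax \<turnstile>\<^sub>T S_ax"
proof -
  show K: "sig_ctx \<turnstile>\<^sub>T K_ax" unfolding K_ax_def by (intro K_law_ty sig_ctx_wf sig_ops_ty)
  show "sig_ctx \<triangleright> K_ax \<turnstile>\<^sub>T S_ax" unfolding S_ax_def
    by (rule ty_subst_cong[OF S_law_ty p_cong]) (rule sig_ctx_wf sig_ops_ty K)+
qed

lemma cl_ctx_wf: "\<turnstile>\<^sub>c cl_ctx"
  unfolding cl_ctx_def by (intro extend_ty sig_ctx_wf axioms_ty)

lemma to_sig_ty: "cl_ctx \<turnstile>\<^sub>s to_sig : sig_ctx"
  unfolding cl_ctx_def to_sig_def by (rule comp_cong[OF p_cong p_cong]) (rule axioms_ty)+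

lemma axiom_witnesses:
  "cl_ctx \<turnstile>\<^sub>t q\<^bsub>K_ax\<^esub>[p\<^bsub>S_ax\<^esub>]\<^sub>t : K_ax[to_sig]\<^sub>T"
  "cl_ctx \<turnstile>\<^sub>t q\<^bsub>S_ax\<^esub> : (S_law sig_ctx op_app op_S)[to_sig]\<^sub>T"
proof -
  have pK: "sig_ctx \<triangleright> K_ax \<turnstile>\<^sub>s p\<^bsub>K_ax\<^esub> : sig_ctx" by (rule p_cong axioms_ty)+
  have pS: "cl_ctx \<turnstile>\<^sub>s p\<^bsub>S_ax\<^esub> : sig_ctx \<triangleright> K_ax" unfolding cl_ctx_def by (rule p_cong axioms_ty)+
  show "cl_ctx \<turnstile>\<^sub>t q\<^bsub>K_ax\<^esub>[p\<^bsub>S_ax\<^esub>]\<^sub>t : K_ax[to_sig]\<^sub>T"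
    unfolding to_sig_def
    by (rule tm_conv[OF cl_ctx_wf tm_subst_cong[OF q_cong[OF axioms_ty(1)] pS] ty_sym[OF ty_subst_comp[OF axioms_ty(1) pK pS]]])
  have S: "sig_ctx \<turnstile>\<^sub>T S_law sig_ctx op_app op_S" by (intro S_law_ty sig_ctx_wf sig_ops_ty)
  have "cl_ctx \<turnstile>\<^sub>t q\<^bsub>S_ax\<^esub> : S_ax[p\<^bsub>S_ax\<^esub>]\<^sub>T" unfolding cl_ctx_def by (rule q_cong axioms_ty)+
  then show "cl_ctx \<turnstile>\<^sub>t q\<^bsub>S_ax\<^esub> : (S_law sig_ctx op_app op_S)[to_sig]\<^sub>T"
    using tm_conv[OF cl_ctx_wf _ ty_sym[OF ty_subst_comp[OF S pK pS]]] unfolding S_ax_def to_sig_def by blast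
qed

lemma cl_tm_ty: "cl_ctx \<turnstile>\<^sub>t cl_tm t : obj cl_ctx"
proof (induction t)
  case (CApp t u)
  then show ?case
    by (simp, intro ap2_cong cl_ctx_wf wk_tm[OF sig_ctx_wf cl_ctx_wf to_sig_ty] sig_ops_ty binop_ty)
qed (simp_all add: wk_tm[OF sig_ctx_wf cl_ctx_wf to_sig_ty base_cong] sig_ops_ty)

lemma cl_eq_derivable: "cl_eq t u \<Longrightarrow> cl_ctx \<turnstile>\<^sub>t cl_tm t \<approx> cl_tm u : obj cl_ctx"
proof (induction rule: cl_eq.induct)
  case (app t t' u u')
  then show ?case
    by (simp, intro ap2_cong cl_ctx_wf wk_tm[OF sig_ctx_wf cl_ctx_wf to_sig_ty] sig_ops_ty binop_ty)
next
  case (K t u)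
  show ?case
    by (simp, rule K_law_inst[OF sig_ctx_wf cl_ctx_wf to_sig_ty sig_ops_ty(1,2) axiom_witnesses(1)[unfolded K_ax_def]])
      (rule cl_tm_ty)+
next
  case (S t u v)
  show ?case
    by (simp, rule S_law_inst[OF sig_ctx_wf cl_ctx_wf to_sig_ty sig_ops_ty(1,3) axiom_witnesses(2)]) (rule cl_tm_ty)+
qed (blast intro: cl_tm_ty tm_sym tm_trans)+

definition point :: "cl \<Rightarrow> sub" where
  "point t = \<langle>\<langle>\<rangle>\<^bsub>cl_ctx\<^esub>, cl_tm t\<rangle>\<^bsub>TBase\<^esub>"

lemma point_ty: "cl_ctx \<turnstile>\<^sub>s point t : Empty \<triangleright> TBase"
  unfolding point_def by (intro spair_cong base_cong terminal_ty cl_ctx_wf cl_tm_ty)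

text \<open>
  Since \<^term>\<open>cI \<cdot> x \<cdot> y = x \<cdot> y\<close>, the innermost \<^const>\<open>cI\<close> paired on the right interprets the binary operation;
  the two outer ones are the irrelevant realisers of the laws.
\<close>

definition "cl_env = cPair \<cdot> (cPair \<cdot> (cPair \<cdot> (cPair \<cdot> (cPair \<cdot> cI \<cdot> cI) \<cdot> cK) \<cdot> cS) \<cdot> cI) \<cdot> cI"

text \<open>As \<open>TBase\<close> denotes equality of combinators, the two laws unfold at this
  environment to the defining equations of \<open>cK\<close> and \<open>cS\<close>.\<close>

lemma cl_env_valid: "ctx_rel cl_ctx cl_env cl_env"
  by (simp add: cl_ctx_def sig_ctx_def op_ctx_def cl_env_def K_ax_def K_law_def K_body_def S_ax_def S_law_def S_body_def
      ap2_def op_app_def op_K_def op_S_def ext_def Let_def)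

lemma tm_val_cl_tm: "tm_val (cl_tm t) \<cdot> cl_env = abs_comb t"
proof (induction t)
  case (CApp t u)
  then show ?case
    by (simp add: ap2_def to_sig_def op_app_def cl_env_def ap.abs_eq)
qed (simp_all add: to_sig_def op_K_def op_S_def cl_env_def cK_def cS_def)

theorem point_eq_iff: "cl_ctx \<turnstile>\<^sub>s point t \<approx> point u : Empty \<triangleright> TBase \<longleftrightarrow> abs_comb t = abs_comb u"
proof
  assume "cl_ctx \<turnstile>\<^sub>s point t \<approx> point u : Empty \<triangleright> TBase"
  then have "sem_sub cl_ctx (point t) (point u) (Empty \<triangleright> TBase)" by (rule soundness)
  then show "abs_comb t = abs_comb u"
    \<comment> \<open>At \<open>cl_env\<close> the second components of the two points are the
      classes of \<open>t\<close> and \<open>u\<close>, compared by equality.\<close>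
    using cl_env_valid by (simp add: sem_sub_def val_sub_def point_def ext_def) (metis tm_val_cl_tm)
next
  assume "abs_comb t = abs_comb u"
  then have "cl_eq t u" by (simp add: comb.abs_eq_iff)
  then show "cl_ctx \<turnstile>\<^sub>s point t \<approx> point u : Empty \<triangleright> TBase"
    unfolding point_def by (intro spair_cong base_cong terminal_ty cl_ctx_wf cl_eq_derivable)
qed

section \<open>Arithmetic of codes\<close>

definition recfun :: "nat \<Rightarrow> (nat list \<Rightarrow> nat) \<Rightarrow> bool" where
  "recfun n F \<longleftrightarrow> (\<exists>r. \<forall>xs. length xs = n \<longrightarrow> computes r xs (F xs))"

lemma recfun_proj: "i < n \<Longrightarrow> recfun n (\<lambda>xs. xs ! i)"
  unfolding recfun_def by (rule exI[of _ "RProj i"]) (auto intro: computes.proj)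

lemma recfun_comp1:
  assumes "recfun 1 F" "recfun n G"
  shows "recfun n (\<lambda>xs. F [G xs])"
proof -
  from assms obtain f g where "\<forall>ys. length ys = 1 \<longrightarrow> computes f ys (F ys)"
    "\<forall>xs. length xs = n \<longrightarrow> computes g xs (G xs)"
    unfolding recfun_def by blast
  then have "length xs = n \<longrightarrow> computes (RComp f [g]) xs (F [G xs])" for xs
    by (auto intro!: computes.comp[where ys = "[G xs]"])
  then show ?thesis unfolding recfun_def by blast
qed

lemma recfun_comp2:
  assumes "recfun 2 F" "recfun n G" "recfun n H"
  shows "recfun n (\<lambda>xs. F [G xs, H xs])"
proof -
  from assms obtain f g h where "\<forall>ys. length ys = 2 \<longrightarrow> computes f ys (F ys)"
    "\<forall>xs. length xs = n \<longrightarrow> computes g xs (G xs)" "\<forall>xs. length xs = n \<longrightarrow> computes h xs (H xs)"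
    unfolding recfun_def by blast
  then have "length xs = n \<longrightarrow> computes (RComp f [g, h]) xs (F [G xs, H xs])" for xs
    by (auto intro!: computes.comp[where ys = "[G xs, H xs]"])
  then show ?thesis unfolding recfun_def by blast
qed

lemma recfun_Suc: "recfun n F \<Longrightarrow> recfun n (\<lambda>xs. Suc (F xs))"
proof -
  have "recfun 1 (\<lambda>xs. Suc (hd xs))"
    unfolding recfun_def by (rule exI[of _ RSuc]) (auto simp: length_Suc_conv intro: computes.suc)
  then show "recfun n F \<Longrightarrow> recfun n (\<lambda>xs. Suc (F xs))"
    using recfun_comp1[of "\<lambda>xs. Suc (hd xs)" n F] by simp
qed

lemma recfun_const: "recfun n (\<lambda>_. c)"
proof (induction c)
  case 0
  show ?case unfolding recfun_def by (auto intro: computes.zero)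
qed (rule recfun_Suc)

lemma recfun_prim:
  assumes "recfun n F" "recfun (Suc (Suc n)) G"
    and "\<And>xs. length xs = n \<Longrightarrow> H (0 # xs) = F xs"
    and "\<And>k xs. length xs = n \<Longrightarrow> H (Suc k # xs) = G (k # H (k # xs) # xs)"
  shows "recfun (Suc n) H"
proof -
  from assms(1,2) obtain f g where f: "\<And>xs. length xs = n \<Longrightarrow> computes f xs (F xs)"
    and g: "\<And>xs. length xs = Suc (Suc n) \<Longrightarrow> computes g xs (G xs)"
    unfolding recfun_def by blast
  have "computes (RPrim f g) (k # xs) (H (k # xs))" if "length xs = n" for k xs
    using that
  proof (induction k)
    case 0
    then show ?case using f assms(3) by (auto intro: computes.prim_0)
  next
    case (Suc k)
    then show ?case using g[of "k # H (k # xs) # xs"] assms(4) by (auto intro: computes.prim_Suc)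
  qed
  then show ?thesis unfolding recfun_def by (metis length_Suc_conv)
qed

lemma recfun_add: "recfun n F \<Longrightarrow> recfun n G \<Longrightarrow> recfun n (\<lambda>xs. F xs + G xs)"
proof -
  have "recfun (Suc 1) (\<lambda>xs. xs ! 0 + xs ! 1)"
    by (rule recfun_prim[OF recfun_proj[of 0] recfun_Suc[OF recfun_proj[of 1]]]) simp_all
  then show "recfun n F \<Longrightarrow> recfun n G \<Longrightarrow> recfun n (\<lambda>xs. F xs + G xs)"
    using recfun_comp2[of "\<lambda>xs. xs ! 0 + xs ! 1" n F G] by (simp add: numeral_2_eq_2)
qed

lemma recfun_triangle: "recfun n F \<Longrightarrow> recfun n (\<lambda>xs. triangle (F xs))"
proof -
  have "recfun (Suc 0) (\<lambda>xs. triangle (xs ! 0))"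
    by (rule recfun_prim[OF recfun_const[of 0 0] recfun_add[OF recfun_proj[of 1]
          recfun_Suc[OF recfun_proj[of 0]]]]) simp_all
  then show "recfun n F \<Longrightarrow> recfun n (\<lambda>xs. triangle (F xs))"
    using recfun_comp1[of "\<lambda>xs. triangle (xs ! 0)" n F] by simp
qed

text \<open>The code of a nonempty list is the successor of the Cantor pairing
  \<open>triangle (m + n) + m\<close> of head and coded tail, so addition, successor and triangular
  numbers suffice.\<close>

lemma recfun_list_encode_Cons:
  "recfun n F \<Longrightarrow> recfun n (\<lambda>xs. list_encode (L xs)) \<Longrightarrow> recfun n (\<lambda>xs. list_encode (F xs # L xs))"
  by (simp add: prod_encode_def, intro recfun_Suc recfun_add recfun_triangle)

lemma recfun_list_encode_Nil: "recfun n (\<lambda>xs. list_encode [])"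
  by (rule recfun_const)

lemmas recfun_list_encode = recfun_list_encode_Cons recfun_list_encode_Nil

text \<open>The syntax of \<open>ap2\<close> on codes, with 7 the tag of \<open>App\<close>. It is
  defined for arbitrary numbers, so that programs can use it without decoding.\<close>

definition code_CApp :: "nat \<Rightarrow> nat \<Rightarrow> nat" where
  "code_CApp a b = list_encode [7, code_ty (obj cl_ctx), code_ty (wk TBase (xt cl_ctx)),
     list_encode [7, code_ty (obj cl_ctx), code_ty (wk (arr TBase TBase) (xt cl_ctx)), code_tm (op_app[to_sig]\<^sub>t), a], b]"

lemma code_cl_tm_CApp: "code_tm (cl_tm (CApp t u)) = code_CApp (code_tm (cl_tm t)) (code_tm (cl_tm u))"
  by (simp add: ap2_def code_CApp_def del: list_encode.simps)

lemma recfun_code_CApp: "recfun n F \<Longrightarrow> recfun n G \<Longrightarrow> recfun n (\<lambda>xs. code_CApp (F xs) (G xs))"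
  unfolding code_CApp_def by (intro recfun_list_encode recfun_const)

lemma abs_rep_comb: "abs_comb (rep_comb x) = x"
  by (rule Quotient_abs_rep[OF Quotient_comb])

text \<open>A representative of \<open>cSuc\<close> is fixed once and for all. Its code is then a
  constant, and the code of a numeral arises by primitive recursion.\<close>

primrec numeral_cl :: "nat \<Rightarrow> cl" where
  "numeral_cl 0 = CK"
| "numeral_cl (Suc n) = CApp (rep_comb cSuc) (numeral_cl n)"

lemma abs_numeral_cl: "abs_comb (numeral_cl n) = num n"
  by (induction n) (simp_all add: cK_def abs_rep_comb flip: ap.abs_eq)

lemma recfun_numeral_cl: "recfun n F \<Longrightarrow> recfun n (\<lambda>xs. code_tm (cl_tm (numeral_cl (F xs))))"
proof -
  have "recfun (Suc 0) (\<lambda>xs. code_tm (cl_tm (numeral_cl (xs ! 0))))"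
    by (rule recfun_prim[OF recfun_const[of 0 "code_tm (cl_tm CK)"]
          recfun_code_CApp[OF recfun_const[of _ "code_tm (cl_tm (rep_comb cSuc))"] recfun_proj[of 1]]])
      (simp_all add: code_cl_tm_CApp del: cl_tm.simps(3))
  then show "recfun n F \<Longrightarrow> recfun n (\<lambda>xs. code_tm (cl_tm (numeral_cl (F xs))))"
    using recfun_comp1[of "\<lambda>xs. code_tm (cl_tm (numeral_cl (xs ! 0)))" n F] by simp
qed

text \<open>A decision procedure would in particular decide convertibility to \<open>CK\<close>. The
  program that applies it to the self-application of a coded term is represented by a combinator,
  and the self-application of that combinator is decided wrongly.\<close>

theorem theorem2p3:
  shows "\<not> (\<exists>f :: recf. \<forall>(\<Gamma> :: ctx) (\<Delta> :: ctx) (\<gamma> :: sub) (\<gamma>' :: sub).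
    \<Gamma> \<turnstile>\<^sub>s \<gamma> : \<Delta> \<and> \<Gamma> \<turnstile>\<^sub>s \<gamma>' : \<Delta> \<longrightarrow>
      computes f [code_ctx \<Gamma>, code_ctx \<Delta>, code_sub \<gamma>, code_sub \<gamma>']
        (if \<Gamma> \<turnstile>\<^sub>s \<gamma> \<approx> \<gamma>' : \<Delta> then 1 else 0))"
proof
  assume "\<exists>f. \<forall>\<Gamma> \<Delta> \<gamma> \<gamma>'. \<Gamma> \<turnstile>\<^sub>s \<gamma> : \<Delta> \<and> \<Gamma> \<turnstile>\<^sub>s \<gamma>' : \<Delta> \<longrightarrow>
      computes f [code_ctx \<Gamma>, code_ctx \<Delta>, code_sub \<gamma>, code_sub \<gamma>']
        (if \<Gamma> \<turnstile>\<^sub>s \<gamma> \<approx> \<gamma>' : \<Delta> then 1 else 0)"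
  then obtain f where f: "\<And>\<Gamma> \<Delta> \<gamma> \<gamma>'. \<Gamma> \<turnstile>\<^sub>s \<gamma> : \<Delta> \<Longrightarrow> \<Gamma> \<turnstile>\<^sub>s \<gamma>' : \<Delta> \<Longrightarrow>
      computes f [code_ctx \<Gamma>, code_ctx \<Delta>, code_sub \<gamma>, code_sub \<gamma>']
        (if \<Gamma> \<turnstile>\<^sub>s \<gamma> \<approx> \<gamma>' : \<Delta> then 1 else 0)"
    by blast
  \<comment> \<open>The term \<open>t\<close> applied to the one-element argument list holding its
    own code, in the format of \<open>enc\<close>; the final \<open>CK\<close> is the empty
    list.\<close>
  define self where "self t = CApp t (CApp (CApp (rep_comb cPair) (numeral_cl (code_tm (cl_tm t)))) CK)" for t
  \<comment> \<open>The code of \<open>point (self t)\<close> as a numerical function of the code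
    \<open>x\<close> of \<open>t\<close>; 4 is the tag of \<open>SPair\<close>.\<close>
  define F where "F x = list_encode [4, code_sub \<langle>\<rangle>\<^bsub>cl_ctx\<^esub>,
    code_CApp x (code_CApp (code_CApp (code_tm (cl_tm (rep_comb cPair))) (code_tm (cl_tm (numeral_cl x))))
      (code_tm (cl_tm CK))), code_ty TBase]" for x
  have "recfun 1 (\<lambda>xs. F (xs ! 0))"
    unfolding F_def
    by (intro recfun_list_encode recfun_code_CApp recfun_numeral_cl recfun_const recfun_proj) simp_all
  then obtain r where "\<forall>xs. length xs = 1 \<longrightarrow> computes r xs (F (xs ! 0))" unfolding recfun_def by blast
  then have r: "computes r [x] (F x)" for x by (elim allE[of _ "[x]"]) simp
  have F: "F (code_tm (cl_tm t)) = code_sub (point (self t))" for t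
    unfolding F_def point_def self_def by (simp only: code_cl_tm_CApp code_sub.simps)
  obtain c where c: "\<And>n x. computes (c n) [x] n"
    using recfun_const[of 1] unfolding recfun_def by (metis One_nat_def length_Cons list.size(3))
  \<comment> \<open>The fixed comparison arrow is the point of \<open>CK\<close>, whose class is the
    numeral 0.\<close>
  define g where "g = RComp f [c (code_ctx cl_ctx), c (code_ctx (Empty \<triangleright> TBase)), r, c (code_sub (point CK))]"
  obtain p where p: "\<And>xs y. computes g xs y \<Longrightarrow> p \<cdot> enc xs = num y" using representable by blast
  define t where "t = rep_comb p"
  define b where "b \<longleftrightarrow> cl_ctx \<turnstile>\<^sub>s point (self t) \<approx> point CK : Empty \<triangleright> TBase"
  have "computes g [code_tm (cl_tm t)] (if b then 1 else 0)"
    unfolding g_def b_def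
    by (rule computes.comp[OF _ f[OF point_ty[of "self t"] point_ty[of CK]]]) (simp add: c r flip: F)
  then have "p \<cdot> enc [code_tm (cl_tm t)] = num (if b then 1 else 0)" by (rule p)
  moreover have "abs_comb (self t) = p \<cdot> enc [code_tm (cl_tm t)]"
    by (simp add: self_def t_def abs_rep_comb abs_numeral_cl cK_def flip: ap.abs_eq)
  moreover have "b \<longleftrightarrow> abs_comb (self t) = num 0"
    by (simp add: b_def point_eq_iff cK_def)
  \<comment> \<open>If \<open>b\<close> holds, the self-application equals both 1 and 0; if it
    fails, the self-application equals 0, which is what \<open>b\<close> asserts.\<close>
  ultimately show False using num_0_neq_num_1 by (cases b) auto
qed

end
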